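(* Fix an integer $d\ge2$. For every $M$-convex set $S\subseteq\Delta_3^d$ and every $\lambda\in\mathbb R_{\ge0}^{I(S)}$, $$H_S(\lambda)=\inf_{\eta\in L_S^\perp}\ \sum_{\beta\in\Delta_3^{d-2}}h_{S_\beta}(\lambda_\beta+\eta_\beta),$$ where $\lambda_\beta,\eta_\beta\in\mathbb R^{m(S_\beta)}$ denote the $\beta$-blocks of $\lambda,\eta\in\mathbb R^{I(S)}$.
   Context: $\mathbb N=\mathbb Z_{\ge0}$, $\Delta_3^d=\{\alpha\in\mathbb N^3:\alpha_1+\alpha_2+\alpha_3=d\}$, $e_1,e_2,e_3$ is the standard basis of $\mathbb R^3$, $\alpha!=\alpha_1!\alpha_2!\alpha_3!$, $\mathbf x^\alpha=x_1^{\alpha_1}x_2^{\alpha_2}x_3^{\alpha_3}$. A nonempty $J\subseteq\Delta_3^d$ is $M$-convex if for all $\alpha,\beta\in J$ and every $i$ with $\alpha_i>\beta_i$ there is $j$ with $\alpha_j<\beta_j$ such that $\alpha-e_i+e_j\in J$ and $\beta-e_j+e_i\in J$. Homogeneous polynomials of degree $d\ge2$ with nonnegative coefficients are written $f=\sum_{\alpha\in S}c_\alpha\mathbf x^\alpha/\alpha!$ with $c_\alpha>0$ for $\alpha\in S=\operatorname{supp}(f)$ and $c_\alpha=0$ otherwise. For $\beta\in\Delta_3^{d-2}$ put $H_\beta(f)=(c_{\beta+e_i+e_j})_{1\le i,j\le3}$. $f$ is Lorentzian if its support is $M$-convex and every $H_\beta(f)$ has at most one positive eigenvalue. $\mathcal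 L_S^+$ is the set of Lorentzian $f$ with support exactly $S$. For $\beta\in\Delta_3^{d-2}$ let $S_\beta=\{e_i+e_j:\beta+e_i+e_j\in S\}\subseteq\Delta_3^2$ (each $S_\beta$ is empty or $M$-convex). Local generators: let $T\subseteq\Delta_3^2$ be empty or $M$-convex, $\varepsilon_\gamma$ ($\gamma\in T$) the standard basis of $\mathbb R^T$, and write $ij$ for $e_i+e_j$. The local generators for $T$ are: (a) for every $i$, with $\{i,j,k\}=\{1,2,3\}$, such that $ii,jk,ij,ik\in T$: the vector $\varepsilon_{ii}+\varepsilon_{jk}-\varepsilon_{ij}-\varepsilon_{ik}$; (b) if $T=\{ii,ij,jj\}$ with $i\ne j$: the vector $\varepsilon_{ii}+\varepsilon_{jj}-2\varepsilon_{ij}$. There are no others. Fix an ordering $g_{T,1},\dots,g_{T,m(T)}$ of them. A Lorentzian matrix with support $T$ is a real symmetric $3\times3$ matrix $P=(p_{ij})$ with at most one positive eigenvalue, $p_{ij}>0$ if $e_i+e_j\in T$ and $p_{ij}=0$ otherwise. For $w\in\mathbb R^T$, $R_w(P)=\prod_{\alpha\in T}p_\alpha^{w_\alpha}$, where $p_{e_i+e_j}:=p_{ij}$. Let $\mathcal C_T=\{(\log R_{g_{T,1}}(P),\dots,\log R_{g_{T,m(T)}}(P)):P\text{ Lorentzian with support }T\}\subseteq\mathbb R^{m(T)}$ (with $\mathcal C_T=\{0\}=\mathbb R^0$ if $m(T)=0$), and let $h_T(\lambda)=\sup_{x\in\mathcal C_T}\langle\lambda,x\rangle\in(-\infty,+\infty]$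 be its support function. Let $I(S)=\{(\beta,\ell):\beta\in\Delta_3^{d-2},\ 1\le\ell\le m(S_\beta)\}$, so $\mathbb R^{I(S)}\cong\prod_\beta\mathbb R^{m(S_\beta)}$. Define $\rho_S:\mathbb R^S\to\mathbb R^{I(S)}$ by $(\rho_S(a))_{\beta,\ell}=\sum_{\gamma\in S_\beta}(g_{S_\beta,\ell})_\gamma\,a_{\beta+\gamma}$, let $L_S=\operatorname{im}(\rho_S)$, and let $L_S^\perp$ be its orthogonal complement in $\mathbb R^{I(S)}$ for the standard inner product. For $f\in\mathcal L_S^+$ put $R_{\beta,\ell}(f)=R_{g_{S_\beta,\ell}}(H_\beta(f))$. For $\lambda\in\mathbb R_{\ge0}^{I(S)}$, $$H_S(\lambda)=\log\sup_{f\in\mathcal L_S^+}\prod_{(\beta,\ell)\in I(S)}R_{\beta,\ell}(f)^{\lambda_{\beta,\ell}}.$$ *)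

theory Defs
  imports
    "HOL-Analysis.Analysis"
    "HOL-Computational_Algebra.Polynomial"
    "HOL-Library.Poly_Mapping"
begin

section \<open>Multi-indices and M-convex sets\<close>

type_synonym mindex = "nat ^ 3"

abbreviation std :: "3 \<Rightarrow> mindex" where
  "std i \<equiv> axis i 1"

definition simplex_pts :: "nat \<Rightarrow> mindex set" where
  "simplex_pts d = {\<alpha>. (\<Sum>i\<in>UNIV. \<alpha> $ i) = d}"

text \<open>Subtraction on natural vectors truncates, but below it is only applied to
  \<open>std i\<close> when the \<open>i\<close>-th coordinate is positive.\<close>

definition M_convex :: "nat \<Rightarrow> mindex set \<Rightarrow> bool" where
  "M_convex d J \<longleftrightarrow> J \<noteq> {} \<and> J \<subseteq> simplex_pts d \<and>
     (\<forall>\<alpha>\<in>J. \<forall>\<beta>\<in>J. \<forall>i. \<alpha> $ i > \<beta> $ i \<longrightarrow>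
        (\<exists>j. \<alpha> $ j < \<beta> $ j \<and> \<alpha> - std i + std j \<in> J \<and> \<beta> - std j + std i \<in> J))"


section \<open>Real matrices with at most one positive eigenvalue\<close>

definition charpoly :: "real ^ 'n ^ 'n \<Rightarrow> real poly" where
  "charpoly A = det (\<chi> i j. (if i = j then [:0, 1:] else 0) - [: A $ i $ j :])"

text \<open>Eigenvalues are counted with (algebraic) multiplicity.\<close>

definition at_most_one_pos_eigenvalue :: "real ^ 'n ^ 'n \<Rightarrow> bool" where
  "at_most_one_pos_eigenvalue A \<longleftrightarrow> size {#x \<in># proots (charpoly A). x > 0#} \<le> 1"


section \<open>Lorentzian polynomials in three variables\<close>

text \<open>A polynomial is a finitely supported map from exponents to (ordinary) coefficients.
  Its support is \<open>Poly_Mapping.keys f\<close>, and \<open>norm_coeff f \<alpha>\<close> is the coefficient of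
  \<open>f\<close> at \<open>x^\<alpha> / \<alpha>!\<close>.\<close>

type_synonym poly3 = "mindex \<Rightarrow>\<^sub>0 real"

definition norm_coeff :: "poly3 \<Rightarrow> mindex \<Rightarrow> real" where
  "norm_coeff f \<alpha> = (\<Prod>i\<in>UNIV. fact (\<alpha> $ i)) * Poly_Mapping.lookup f \<alpha>"

definition hess :: "poly3 \<Rightarrow> mindex \<Rightarrow> real ^ 3 ^ 3" where
  "hess f \<beta> = (\<chi> i j. norm_coeff f (\<beta> + std i + std j))"

definition lorentzian :: "nat \<Rightarrow> poly3 \<Rightarrow> bool" where
  "lorentzian d f \<longleftrightarrow> Poly_Mapping.keys f \<subseteq> simplex_pts d \<and> (\<forall>\<alpha>. 0 \<le> Poly_Mapping.lookup f \<alpha>) \<and>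
     M_convex d (Poly_Mapping.keys f) \<and>
     (\<forall>\<beta>\<in>simplex_pts (d - 2). at_most_one_pos_eigenvalue (hess f \<beta>))"

definition lorentzian_with_support :: "nat \<Rightarrow> mindex set \<Rightarrow> poly3 set" where
  "lorentzian_with_support d S = {f. lorentzian d f \<and> Poly_Mapping.keys f = S}"


section \<open>Local generators\<close>

definition local_support :: "mindex set \<Rightarrow> mindex \<Rightarrow> mindex set" where
  "local_support S \<beta> = {std i + std j | i j. \<beta> + std i + std j \<in> S}"

text \<open>The coordinate space of a finite index set \<open>A\<close> is realised as the functions
  vanishing outside \<open>A\<close>.\<close>

definition coord_space :: "'i set \<Rightarrow> ('i \<Rightarrow> real) set" where
  "coord_space A = {v. \<forall>i. i \<notin> A \<longrightarrow> v i = 0}"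

abbreviation basis_vec :: "mindex \<Rightarrow> mindex \<Rightarrow> real" where
  "basis_vec \<gamma> \<equiv> indicator {\<gamma>}"

definition local_generators :: "mindex set \<Rightarrow> (mindex \<Rightarrow> real) set" where
  "local_generators T =
     {u. \<exists>i j k. {i, j, k} = UNIV \<and>
           std i + std i \<in> T \<and> std j + std k \<in> T \<and> std i + std j \<in> T \<and> std i + std k \<in> T \<and>
           u = (\<lambda>\<gamma>. basis_vec (std i + std i) \<gamma> + basis_vec (std j + std k) \<gamma>
                   - basis_vec (std i + std j) \<gamma> - basis_vec (std i + std k) \<gamma>)} \<union>
     {u. \<exists>i j. i \<noteq> j \<and> T = {std i + std i, std i + std j, std j + std j} \<and>
           u = (\<lambda>\<gamma>. basis_vec (std i + std i) \<gamma> + basis_vec (std j + std j) \<gamma>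
                   - 2 * basis_vec (std i + std j) \<gamma>)}"

type_synonym generators = "mindex set \<Rightarrow> (mindex \<Rightarrow> real) list"

text \<open>A choice, for every admissible \<open>T\<close>, of an ordering of the local generators.
  The \<open>l\<close>-th generator for \<open>T\<close> is \<open>g T ! l\<close>, counted from 0.\<close>

definition generator_ordering :: "generators \<Rightarrow> bool" where
  "generator_ordering g \<longleftrightarrow>
     (\<forall>T. T = {} \<or> M_convex 2 T \<longrightarrow> distinct (g T) \<and> set (g T) = local_generators T)"

lemma finite_local_generators: "finite (local_generators T)"
proof -
  define A :: "3 \<Rightarrow> 3 \<Rightarrow> 3 \<Rightarrow> mindex \<Rightarrow> real" where
    "A i j k = (\<lambda>\<gamma>. basis_vec (std i + std i) \<gamma> + basis_vec (std j + std k) \<gamma>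
                   - basis_vec (std i + std j) \<gamma> - basis_vec (std i + std k) \<gamma>)" for i j k
  define B :: "3 \<Rightarrow> 3 \<Rightarrow> mindex \<Rightarrow> real" where
    "B i j = (\<lambda>\<gamma>. basis_vec (std i + std i) \<gamma> + basis_vec (std j + std j) \<gamma>
                   - 2 * basis_vec (std i + std j) \<gamma>)" for i j
  have "local_generators T \<subseteq> (\<Union>i j k. {A i j k}) \<union> (\<Union>i j. {B i j})"
    unfolding local_generators_def A_def[symmetric] B_def[symmetric] by blast
  moreover have "finite ((\<Union>i j k. {A i j k}) \<union> (\<Union>i j. {B i j}))"
    by (intro finite_UnI finite_UN_I finite) auto
  ultimately show ?thesis
    by (rule finite_subset)
qed

lemma ex_generator_ordering: "\<exists>g. generator_ordering g"
proof -
  have "\<exists>xs. distinct xs \<and> set xs = local_generators T" for T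
    using finite_distinct_list[OF finite_local_generators] by blast
  then have "\<exists>g. \<forall>T. distinct (g T) \<and> set (g T) = local_generators T"
    by (intro choice allI)
  then show ?thesis
    unfolding generator_ordering_def by blast
qed


section \<open>Lorentzian matrices and local support functions\<close>

definition lorentzian_matrix :: "mindex set \<Rightarrow> real ^ 3 ^ 3 \<Rightarrow> bool" where
  "lorentzian_matrix T P \<longleftrightarrow> transpose P = P \<and> at_most_one_pos_eigenvalue P \<and>
     (\<forall>i j. (std i + std j \<in> T \<longrightarrow> P $ i $ j > 0) \<and> (std i + std j \<notin> T \<longrightarrow> P $ i $ j = 0))"

text \<open>\<open>sym_entry P \<gamma>\<close> is the entry of the symmetric matrix \<open>P\<close> at any position
  \<open>(i, j)\<close> with \<open>\<gamma> = std i + std j\<close>; see \<open>sym_entry_std\<close>.\<close>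

definition sym_entry :: "real ^ 3 ^ 3 \<Rightarrow> mindex \<Rightarrow> real" where
  "sym_entry P \<gamma> = (THE p. \<exists>i j. \<gamma> = std i + std j \<and> p = P $ i $ j)"

lemma axis_nth_std: "std i $ m = (if m = i then 1 else 0)"
  by (auto simp: axis_def)

lemma std_add_eq_iff:
  "std i + std j = std k + std l \<longleftrightarrow> (i = k \<and> j = l) \<or> (i = l \<and> j = k)"
proof
  assume eq: "std i + std j = std k + std l"
  have *: "(if m = i then 1 else 0) + (if m = j then 1 else 0)
        = (if m = k then 1 else 0) + (if m = l then 1 else (0::nat))" for m
    using arg_cong[OF eq, of "\<lambda>v. v $ m"] by (simp only: vector_add_component axis_nth_std)
  have "i = k \<or> i = l"
    by (rule ccontr) (use *[of i] in simp)
  then show "(i = k \<and> j = l) \<or> (i = l \<and> j = k)"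
    using *[of j] by (elim disjE) (auto split: if_split_asm)
qed (elim disjE conjE; simp only: add.commute)

lemma sym_entry_std:
  assumes "transpose P = P"
  shows "sym_entry P (std i + std j) = P $ i $ j"
proof -
  have sym: "P $ k $ l = P $ l $ k" for k l
    using arg_cong[OF assms, of "\<lambda>M. M $ k $ l"] by (simp add: transpose_def)
  show ?thesis
    unfolding sym_entry_def
  proof (rule the_equality)
    show "\<exists>k l. std i + std j = std k + std l \<and> P $ i $ j = P $ k $ l"
      by (intro exI conjI; rule refl)
  next
    fix p assume "\<exists>k l. std i + std j = std k + std l \<and> p = P $ k $ l"
    then obtain k l where "std i + std j = std k + std l" and p: "p = P $ k $ l"
      by (elim exE conjE)
    then have "(i = k \<and> j = l) \<or> (i = l \<and> j = k)"
      by (simp only: std_add_eq_iff)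
    then show "p = P $ i $ j"
      by (elim disjE conjE) (simp_all only: p sym[of k l])
  qed
qed

definition ratio :: "mindex set \<Rightarrow> (mindex \<Rightarrow> real) \<Rightarrow> real ^ 3 ^ 3 \<Rightarrow> real" where
  "ratio T w P = (\<Prod>\<alpha>\<in>T. sym_entry P \<alpha> powr w \<alpha>)"

definition local_set :: "generators \<Rightarrow> mindex set \<Rightarrow> (nat \<Rightarrow> real) set" where
  "local_set g T =
     (if g T = [] then {\<lambda>_. 0}
      else {\<lambda>l. if l < length (g T) then ln (ratio T (g T ! l) P) else 0 | P.
              lorentzian_matrix T P})"

definition local_support_fun :: "generators \<Rightarrow> mindex set \<Rightarrow> (nat \<Rightarrow> real) \<Rightarrow> ereal" where
  "local_support_fun g T v = (SUP x\<in>local_set g T. ereal (\<Sum>l<length (g T). v l * x l))"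


section \<open>The global objects\<close>

definition gen_index :: "generators \<Rightarrow> nat \<Rightarrow> mindex set \<Rightarrow> (mindex \<times> nat) set" where
  "gen_index g d S = (SIGMA \<beta>:simplex_pts (d - 2). {..<length (g (local_support S \<beta>))})"

definition rho :: "generators \<Rightarrow> nat \<Rightarrow> mindex set \<Rightarrow> (mindex \<Rightarrow> real) \<Rightarrow> mindex \<times> nat \<Rightarrow> real" where
  "rho g d S a = (\<lambda>(\<beta>, l). if (\<beta>, l) \<in> gen_index g d S
      then \<Sum>\<gamma>\<in>local_support S \<beta>. (g (local_support S \<beta>) ! l) \<gamma> * a (\<beta> + \<gamma>) else 0)"

definition L_space :: "generators \<Rightarrow> nat \<Rightarrow> mindex set \<Rightarrow> (mindex \<times> nat \<Rightarrow> real) set" where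
  "L_space g d S = rho g d S ` coord_space S"

definition L_perp :: "generators \<Rightarrow> nat \<Rightarrow> mindex set \<Rightarrow> (mindex \<times> nat \<Rightarrow> real) set" where
  "L_perp g d S = {\<eta> \<in> coord_space (gen_index g d S).
     \<forall>x\<in>L_space g d S. (\<Sum>p\<in>gen_index g d S. \<eta> p * x p) = 0}"

definition poly_ratio :: "generators \<Rightarrow> mindex set \<Rightarrow> poly3 \<Rightarrow> mindex \<times> nat \<Rightarrow> real" where
  "poly_ratio g S f = (\<lambda>(\<beta>, l).
     ratio (local_support S \<beta>) (g (local_support S \<beta>) ! l) (hess f \<beta>))"

text \<open>The logarithm on the extended half-line, with \<open>log 0 = -\<infinity>\<close> and
  \<open>log \<infinity> = \<infinity>\<close>.\<close>

definition ereal_ln :: "ereal \<Rightarrow> ereal" where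
  "ereal_ln x = (if x \<le> 0 then -\<infinity> else if x = \<infinity> then \<infinity> else ereal (ln (real_of_ereal x)))"

definition H_fun :: "generators \<Rightarrow> nat \<Rightarrow> mindex set \<Rightarrow> (mindex \<times> nat \<Rightarrow> real) \<Rightarrow> ereal" where
  "H_fun g d S lam = ereal_ln (SUP f\<in>lorentzian_with_support d S.
     ereal (\<Prod>p\<in>gen_index g d S. poly_ratio g S f p powr lam p))"

end

theory Submission
  imports Defs
begin

text \<open>
  Write a polynomial with support \<open>S\<close> through the logarithms \<open>a\<close> of its normalised coefficients. The
  logarithms of the ratios are then linear in \<open>a\<close>, with image \<open>L\<close>, and the formula is a
  Fenchel duality: on the left the linear functional \<open>\<lambda>\<close> is maximised over \<open>L \<inter> C\<close>, where \<open>C\<close> is the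
  product of the local sets, and on the right one minimises, over \<open>\<eta> \<in> L\<^sup>\<bottom>\<close>, the support function of \<open>C\<close>
  at \<open>\<lambda> + \<eta>\<close>, which is the sum of the local support functions. One inequality is immediate
  (\<open>weak_duality\<close>). The other needs three facts about \<open>C\<close>.

  \<^item> The local sets are convex. A symmetric matrix \<open>P\<close> of size 3 with nonnegative entries has at
    most one positive eigenvalue if and only if
    \<open>P\<^sub>i\<^sub>i P(v, v) \<le> P(e\<^sub>i, v)\<^sup>2\<close> for all \<open>i\<close> and all \<open>v\<close> in the nonnegative span of the other two unit
    vectors (\<open>at_most_one_pos_eigenvalue_iff_reverse_CS\<close>). After rescaling \<open>v\<close>, this reads
    \<open>A s\<^sup>2 + 2 B s t + A' t\<^sup>2 \<le> (s + t)\<^sup>2\<close> for \<open>s, t \<ge> 0\<close>, where each of \<open>A\<close>, \<open>B\<close> and \<open>A'\<close> is either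
    zero or a Laurent monomial in the nonzero entries of \<open>P\<close>, hence the exponential of a linear
    function of their logarithms. So the logarithms of the Lorentzian matrices with a given support
    form a convex set (\<open>lorentz_logs_convex\<close>).

  \<^item> The exponents of these monomials are local generators or sums of two of them. Hence being
    Lorentzian depends only on the generator ratios, and persists when these decrease
    (\<open>lorentz_logs_downward_closed\<close>). The first consequence is that \<open>L \<inter> C\<close> is exactly the set of
    log-ratio vectors of Lorentzian polynomials (\<open>rho_log_coeffs\<close>).

  \<^item> The second consequence is that \<open>C\<close> contains the nonpositive orthant. The log-coefficients
    \<open>-\<bar>\<alpha>\<bar>\<^sup>2\<close> have strictly negative generator values, so \<open>L\<close> meets the interior of \<open>C\<close>
    (\<open>interior_point\<close>).

  Given these, a bound for \<open>\<lambda>\<close> on \<open>L \<inter> C\<close> extends, by a Hahn-Banach argument that adds one coordinate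
  at a time (\<open>bounded_functional_extends\<close>), to a bound on \<open>C\<close> for a functional that agrees with \<open>\<lambda>\<close>
  on \<open>L\<close>; the difference of the two is the required \<open>\<eta>\<close>.
\<close>

section \<open>Symmetric matrices with at most one positive eigenvalue\<close>

definition minor_sum :: "real ^ 3 ^ 3 \<Rightarrow> real" where
  "minor_sum A = (A$1$1 * A$2$2 - A$1$2 * A$2$1) + (A$1$1 * A$3$3 - A$1$3 * A$3$1)
     + (A$2$2 * A$3$3 - A$2$3 * A$3$2)"

lemma charpoly_3:
  "charpoly (A :: real ^ 3 ^ 3) =
     [: - det A, minor_sum A, - (A$1$1 + A$2$2 + A$3$3), 1 :]"
  unfolding charpoly_def det_3 minor_sum_def
  by (simp add: algebra_simps)

text \<open>Complete the square after multiplying by \<open>u\<close>; if \<open>u = 0\<close>, then \<open>f = 0\<close> as well.\<close>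

lemma binary_form_nonneg:
  fixes d e f u v :: real
  assumes "f\<^sup>2 \<le> u * v" "0 \<le> u" "0 \<le> v"
  shows "0 \<le> u * d\<^sup>2 + 2 * f * d * e + v * e\<^sup>2"
proof (cases "u = 0")
  case True
  then show ?thesis using assms by simp
next
  case False
  have "u * (u * d\<^sup>2 + 2 * f * d * e + v * e\<^sup>2) = (u * d + f * e)\<^sup>2 + e\<^sup>2 * (u * v - f\<^sup>2)"
    by algebra
  also have "\<dots> \<ge> 0" using assms(1) by simp
  finally show ?thesis using False assms(2) by (simp add: zero_le_mult_iff)
qed

text \<open>Here \<open>t\<close>, \<open>m\<close> and \<open>D\<close> are, up to sign, the coefficients of the characteristic polynomial \<open>F\<close> of the
  symmetric matrix with diagonal \<open>a, b, c\<close> and off-diagonal entries \<open>d, e, f\<close>. Its roots are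
  real by interlacing: at the two eigenvalues \<open>\<nu> \<le> \<mu>\<close> of the lower right block,
  \<open>F \<nu> \<ge> 0 \<ge> F \<mu>\<close>. So there is a root \<open>r \<ge> \<mu>\<close>, and if the remaining quadratic factor had no
  real root, then it would be positive and \<open>F \<nu> \<ge> 0\<close> would force \<open>r \<le> \<nu>\<close>. This leaves only the
  case of a scalar block, in which the discriminant is visibly a sum of squares.\<close>

lemma symmetric_cubic_splits:
  fixes a b c d e f :: real
  defines "t \<equiv> a + b + c" and "m \<equiv> (a*b - d\<^sup>2) + (a*c - e\<^sup>2) + (b*c - f\<^sup>2)"
    and "D \<equiv> a*b*c + 2*d*e*f - a*f\<^sup>2 - b*e\<^sup>2 - c*d\<^sup>2"
  obtains r s q where "t = r + s + q" "m = r * s + r * q + s * q" "D = r * s * q"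
proof -
  define F where "F = [: - D, m, - t, 1 :]"
  define R where "R = sqrt ((b - c)\<^sup>2 + 4 * f\<^sup>2)"
  have R: "R\<^sup>2 = (b - c)\<^sup>2 + 4 * f\<^sup>2" "0 \<le> R" by (auto simp: R_def)
  have Rb: "\<bar>b - c\<bar> \<le> R"
    unfolding R_def by (intro real_le_rsqrt) auto
  have F: "poly F x = (x - a) * ((x - b) * (x - c) - f\<^sup>2)
      - (d\<^sup>2 * (x - c) + 2*d*e*f + e\<^sup>2 * (x - b))" for x
    unfolding F_def t_def m_def D_def by (simp add: algebra_simps power2_eq_square)
  define \<mu> where "\<mu> = (b + c + R) / 2"
  define \<nu> where "\<nu> = (b + c - R) / 2"
  have mu: "(\<mu> - c) * (\<mu> - b) = f\<^sup>2" "0 \<le> \<mu> - c" "0 \<le> \<mu> - b"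
    and nu: "(c - \<nu>) * (b - \<nu>) = f\<^sup>2" "0 \<le> c - \<nu>" "0 \<le> b - \<nu>"
    using R Rb unfolding \<mu>_def \<nu>_def by (auto simp: field_simps power2_eq_square)
  have "poly F \<mu> \<le> 0"
    using binary_form_nonneg[of f "\<mu> - c" "\<mu> - b" d e] mu by (simp add: F algebra_simps)
  have "poly F \<nu> \<ge> 0"
    using binary_form_nonneg[of f "c - \<nu>" "b - \<nu>" d "- e"] nu by (simp add: F algebra_simps)
  obtain n where n: "\<And>x. x \<ge> n \<Longrightarrow> poly F x \<ge> 1"
    using poly_pinfty_gt_lc[of F] unfolding F_def by auto
  have "\<exists>r\<ge>\<mu>. r \<le> max \<mu> n \<and> poly F r = 0"
    using n[of "max \<mu> n"] \<open>poly F \<mu> \<le> 0\<close>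
    by (intro IVT) auto
  then obtain r where r: "r \<ge> \<mu>" "poly F r = 0" by blast
  define B C where "B = r - t" and "C = m + r * B"
  have D: "D = r * C"
    using r(2) unfolding F_def B_def C_def by (simp add: algebra_simps)
  have fac: "poly F x = (x - r) * (x\<^sup>2 + B * x + C)" for x
    unfolding F_def using D by (simp add: B_def C_def algebra_simps power2_eq_square)
  have "0 \<le> B\<^sup>2 - 4 * C"
  proof (rule ccontr)
    assume neg: "\<not> 0 \<le> B\<^sup>2 - 4 * C"
    have pos: "0 < x\<^sup>2 + B * x + C" for x
    proof -
      have "4 * (x\<^sup>2 + B * x + C) = (2 * x + B)\<^sup>2 + (4 * C - B\<^sup>2)"
        by (simp add: algebra_simps power2_eq_square)
      then show ?thesis using neg by (smt (verit) zero_le_power2)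
    qed
    have "\<nu> \<ge> r"
      using \<open>poly F \<nu> \<ge> 0\<close> pos[of \<nu>] fac[of \<nu>]
      by (metis diff_ge_0_iff_ge not_less zero_le_mult_iff)
    \<comment> \<open>the chain \<nu> \<ge> r \<ge> \<mu> \<ge> \<nu> collapses\<close>
    then have "R = 0" "r = \<mu>" using r(1) R(2) unfolding \<mu>_def \<nu>_def by auto
    then have *: "b = c" "f = 0" "r = b" using R(1) Rb unfolding \<mu>_def by auto
    have "B = - a - b" "C = a * b - d\<^sup>2 - e\<^sup>2"
      unfolding B_def C_def t_def m_def using * by (auto simp: algebra_simps power2_eq_square)
    then have "B\<^sup>2 - 4 * C = (a - b)\<^sup>2 + 4 * (d\<^sup>2 + e\<^sup>2)"
      by algebra
    then show False using neg by simp
  qed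
  define w where "w = sqrt (B\<^sup>2 - 4 * C)"
  have w: "w\<^sup>2 = B\<^sup>2 - 4 * C" using \<open>0 \<le> B\<^sup>2 - 4 * C\<close> by (simp add: w_def)
  define s q where "s = (w - B) / 2" and "q = (- w - B) / 2"
  have sq: "s + q = - B" "s * q = C"
    using w by (auto simp: s_def q_def field_simps power2_eq_square)
  have "t = r + s + q" using sq by (simp add: B_def)
  moreover have "m = r * s + r * q + s * q" using sq C_def by algebra
  moreover have "D = r * s * q" using D sq by (simp add: mult.assoc)
  ultimately show thesis by (rule that)
qed

text \<open>Two nonpositive eigenvalues and a nonnegative trace: the eigenvalue \<open>r\<close> dominates \<open>- (s + q)\<close>,
  and this fixes the signs of the determinant and of the second symmetric function.\<close>

lemma one_positive_imp_signs:
  fixes r s q :: real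
  assumes "s \<le> 0" "q \<le> 0" "0 \<le> r + s + q"
  shows "0 \<le> r * s * q \<and> r * s + r * q + s * q \<le> 0"
proof
  have "0 \<le> r" using assms by linarith
  moreover have "0 \<le> s * q" using assms by (simp add: mult_nonpos_nonpos)
  ultimately show "0 \<le> r * s * q" by (simp add: mult.assoc)
  have "(r + s + q) * (s + q) \<le> 0"
    using assms by (intro mult_nonneg_nonpos) auto
  moreover have "r * s + r * q + s * q = (r + s + q) * (s + q) - s\<^sup>2 - q\<^sup>2 - s * q"
    by (simp add: algebra_simps power2_eq_square)
  ultimately show "r * s + r * q + s * q \<le> 0"
    using \<open>0 \<le> s * q\<close> by (smt (verit) zero_le_power2)
qed

lemma two_positive_imp_signs:
  fixes r s q :: real
  assumes "0 < s" "0 < q" "0 \<le> r * s * q"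
  shows "0 < r * s + r * q + s * q"
proof -
  have "0 \<le> r" using assms by (simp add: zero_le_mult_iff)
  then show ?thesis using assms by (simp add: add_nonneg_pos)
qed

text \<open>The three eigenvalues are real with nonnegative sum, so the largest outweighs the negative ones.
  This is why the signs of the other two elementary symmetric functions decide whether a
  second eigenvalue is positive.\<close>

lemma at_most_one_pos_eigenvalue_iff_signs:
  fixes A :: "real ^ 3 ^ 3"
  assumes sym: "transpose A = A" and tr: "0 \<le> A$1$1 + A$2$2 + A$3$3"
  shows "at_most_one_pos_eigenvalue A \<longleftrightarrow> 0 \<le> det A \<and> minor_sum A \<le> 0"
proof -
  have "A$i$j = A$j$i" for i j
    using arg_cong[OF sym, of "\<lambda>M. M $ i $ j"] by (simp add: transpose_def)
  then have s: "A$2$1 = A$1$2" "A$3$1 = A$1$3" "A$3$2 = A$2$3" by auto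
  obtain r p q where
    t: "A$1$1 + A$2$2 + A$3$3 = r + p + q" and
    m: "minor_sum A = r*p + r*q + p*q" and D: "det A = r*p*q"
    using symmetric_cubic_splits[of "A$1$1" "A$2$2" "A$3$3" "A$1$2" "A$1$3" "A$2$3"]
    unfolding minor_sum_def det_3 s by (auto simp: power2_eq_square algebra_simps)
  have "charpoly A = [:-r,1:] * ([:-p,1:] * [:-q,1:])"
    unfolding charpoly_3 t m D by (simp add: algebra_simps)
  moreover have "proots ([:-r,1:] * ([:-p,1:] * [:-q,1:])) = {#r, p, q#}"
    by (simp add: proots_mult del: mult_pCons_left mult_pCons_right)
  ultimately have "proots (charpoly A) = {#r, p, q#}" by simp
  then have iff: "at_most_one_pos_eigenvalue A \<longleftrightarrow>
      (p \<le> 0 \<and> q \<le> 0) \<or> (r \<le> 0 \<and> q \<le> 0) \<or> (r \<le> 0 \<and> p \<le> 0)"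
    unfolding at_most_one_pos_eigenvalue_def by auto
  show ?thesis
  proof
    assume "at_most_one_pos_eigenvalue A"
    then show "0 \<le> det A \<and> minor_sum A \<le> 0"
      using one_positive_imp_signs[of p q r] one_positive_imp_signs[of r q p]
        one_positive_imp_signs[of r p q] tr
      unfolding iff t m D by (auto simp: algebra_simps)
  next
    assume "0 \<le> det A \<and> minor_sum A \<le> 0"
    then have "0 \<le> r * p * q" "\<not> 0 < r * p + r * q + p * q"
      unfolding m D by auto
    then have "\<not> (0 < p \<and> 0 < q)" "\<not> (0 < r \<and> 0 < q)" "\<not> (0 < r \<and> 0 < p)"
      using two_positive_imp_signs[of p q r] two_positive_imp_signs[of r q p]
        two_positive_imp_signs[of r p q]
      by (auto simp: ac_simps)
    then show "at_most_one_pos_eigenvalue A"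
      unfolding iff by linarith
  qed
qed

text \<open>The local generators are indexed by triples with \<open>{i, j, k} = UNIV\<close>; this turns the condition
  into distinctness.\<close>

lemma triple_3:
  "{i, j, k} = (UNIV :: 3 set) \<longleftrightarrow> i \<noteq> j \<and> i \<noteq> k \<and> j \<noteq> k"
proof -
  have "{i, j, k} = (UNIV :: 3 set) \<longleftrightarrow> card {i, j, k} = 3"
    using card_subset_eq[of "UNIV :: 3 set" "{i, j, k}"] by auto
  then show ?thesis by (auto simp: card_insert_if)
qed

lemma ex_third_index:
  assumes "i \<noteq> j"
  obtains k where "{i, j, k} = (UNIV :: 3 set)"
proof -
  have "card {i, j} \<noteq> card (UNIV :: 3 set)" using assms by simp
  then have "{i, j} \<noteq> UNIV" by metis
  then obtain k where "k \<notin> {i, j}" by blast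
  then show thesis
    by (intro that[of k]) (use assms in \<open>auto simp: triple_3\<close>)
qed

text \<open>Lets later arguments single out any one of the three rows.\<close>

lemma symmetric_invariants:
  fixes A :: "real ^ 3 ^ 3"
  assumes sym: "transpose A = A" and ijk: "{i, j, k} = UNIV"
  shows "det A = A$i$i * A$j$j * A$k$k + 2 * A$i$j * A$i$k * A$j$k
      - A$i$i * (A$j$k)\<^sup>2 - A$j$j * (A$i$k)\<^sup>2 - A$k$k * (A$i$j)\<^sup>2"
    and "minor_sum A = (A$i$i * A$j$j - (A$i$j)\<^sup>2) + (A$i$i * A$k$k - (A$i$k)\<^sup>2)
      + (A$j$j * A$k$k - (A$j$k)\<^sup>2)"
proof -
  have "A$p$q = A$q$p" for p q
    using arg_cong[OF sym, of "\<lambda>M. M $ p $ q"] by (simp add: transpose_def)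
  then have s: "A$2$1 = A$1$2" "A$3$1 = A$1$3" "A$3$2 = A$2$3" by auto
  show "det A = A$i$i * A$j$j * A$k$k + 2 * A$i$j * A$i$k * A$j$k
      - A$i$i * (A$j$k)\<^sup>2 - A$j$j * (A$i$k)\<^sup>2 - A$k$k * (A$i$j)\<^sup>2"
    using ijk exhaust_3[of i] exhaust_3[of j] exhaust_3[of k] s unfolding triple_3 det_3
    by (elim disjE) (simp_all add: power2_eq_square algebra_simps)
  show "minor_sum A = (A$i$i * A$j$j - (A$i$j)\<^sup>2) + (A$i$i * A$k$k - (A$i$k)\<^sup>2)
      + (A$j$j * A$k$k - (A$j$k)\<^sup>2)"
    using ijk exhaust_3[of i] exhaust_3[of j] exhaust_3[of k] s unfolding triple_3 minor_sum_def
    by (elim disjE) (simp_all add: power2_eq_square algebra_simps)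
qed

section \<open>Reverse Cauchy-Schwarz inequalities\<close>

text \<open>The inequality says \<open>P(e\<^sub>i, e\<^sub>i) P(v, v) \<le> P(e\<^sub>i, v)\<^sup>2\<close> for the bilinear form \<open>P\<close> of the matrix,
  with \<open>v = s e\<^sub>j + t e\<^sub>k\<close> restricted to the nonnegative quadrant. The restriction is essential for
  what follows: with \<open>s\<close> and \<open>t\<close> nonnegative, the left-hand side is a sum of monomials
  in the entries with nonnegative coefficients.\<close>

definition reverse_CS :: "real ^ 3 ^ 3 \<Rightarrow> bool" where
  "reverse_CS A \<longleftrightarrow> (\<forall>i j k s t. {i, j, k} = UNIV \<longrightarrow> 0 \<le> s \<longrightarrow> 0 \<le> t \<longrightarrow>
     A$i$i * (A$j$j * s\<^sup>2 + 2 * A$j$k * s * t + A$k$k * t\<^sup>2) \<le> (A$i$j * s + A$i$k * t)\<^sup>2)"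

text \<open>For \<open>p > 0\<close> the difference of the two sides is a binary form in \<open>s\<close> and \<open>t\<close> with coefficients
  \<open>a\<close>, \<open>b\<close>, \<open>c\<close> (minus the Schur complement of \<open>p\<close>, scaled by \<open>p\<close>), whose determinant
  \<open>a c - b\<^sup>2\<close> is \<open>p\<close> times the determinant of the matrix. If the form were negative
  semidefinite and nonzero, then the matrix would be positive semidefinite with a positive sum of
  minors.\<close>

lemma signs_imp_reverse_CS_real:
  fixes p q r x y z s t :: real
  assumes D: "0 \<le> p * q * r + 2 * x * y * z - p * z\<^sup>2 - q * y\<^sup>2 - r * x\<^sup>2"
    and m: "(p * q - x\<^sup>2) + (p * r - y\<^sup>2) + (q * r - z\<^sup>2) \<le> 0"
    and p: "0 \<le> p"
  shows "p * (q * s\<^sup>2 + 2 * z * s * t + r * t\<^sup>2) \<le> (x * s + y * t)\<^sup>2"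
proof (cases "p = 0")
  case False
  with p have p: "0 < p" by simp
  define a b c where "a = x\<^sup>2 - p * q" and "b = x * y - p * z" and "c = y\<^sup>2 - p * r"
  have "a * c - b\<^sup>2 = p * (p * q * r + 2 * x * y * z - p * z\<^sup>2 - q * y\<^sup>2 - r * x\<^sup>2)"
    unfolding a_def b_def c_def by algebra
  with D p have abc: "b\<^sup>2 \<le> a * c" by (smt (verit) zero_le_mult_iff)
  have "0 \<le> a \<and> 0 \<le> c"
  proof (rule ccontr)
    assume neg: "\<not> (0 \<le> a \<and> 0 \<le> c)"
    have "0 \<le> a * c" using abc by (smt (verit) zero_le_power2)
    have "a < 0 \<or> c < 0" using neg by auto
    show False
    proof (cases "a \<le> 0 \<and> c \<le> 0")
      case True
      have "0 \<le> (-a) * y\<^sup>2 + 2 * b * y * x + (-c) * x\<^sup>2"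
        using binary_form_nonneg[of b "-a" "-c" y x] abc True by simp
      moreover have "p\<^sup>2 * (q * r - z\<^sup>2) = ((-a) * y\<^sup>2 + 2 * b * y * x + (-c) * x\<^sup>2) + (a * c - b\<^sup>2)"
        unfolding a_def b_def c_def by algebra
      ultimately have "0 \<le> p\<^sup>2 * (q * r - z\<^sup>2)" using abc by linarith
      then have "0 \<le> q * r - z\<^sup>2" using p by (simp add: zero_le_mult_iff)
      moreover have "- a - c > 0" using True neg by auto
      ultimately show False using m unfolding a_def c_def by linarith
    next
      case False
      with \<open>a < 0 \<or> c < 0\<close> have "a * c < 0"
        by (auto simp: mult_neg_pos mult_pos_neg not_le)
      with \<open>0 \<le> a * c\<close> show False by simp
    qed
  qed
  then have "0 \<le> a * s\<^sup>2 + 2 * b * s * t + c * t\<^sup>2"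
    using binary_form_nonneg[OF abc] by blast
  moreover have "a * s\<^sup>2 + 2 * b * s * t + c * t\<^sup>2
      = (x * s + y * t)\<^sup>2 - p * (q * s\<^sup>2 + 2 * z * s * t + r * t\<^sup>2)"
    unfolding a_def b_def c_def by algebra
  ultimately show ?thesis by linarith
qed simp

text \<open>When the mixed coefficient is nonpositive, changing the sign of one variable can only increase the
  form, so its values on the quadrant already decide semidefiniteness. Accordingly the points
  that yield the discriminant inequality lie in the quadrant because \<open>b \<le> 0\<close>.\<close>

lemma copositive_discriminant:
  fixes a b c :: real
  assumes "\<And>s t. 0 \<le> s \<Longrightarrow> 0 \<le> t \<Longrightarrow> 0 \<le> a * s\<^sup>2 + 2 * b * s * t + c * t\<^sup>2" and "b \<le> 0"
  shows "b\<^sup>2 \<le> a * c"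
proof -
  have a: "0 \<le> a" and c: "0 \<le> c" using assms(1)[of 1 0] assms(1)[of 0 1] by auto
  show ?thesis
  proof (cases "a = 0")
    case True
    have "b = 0"
    proof (rule ccontr)
      assume "b \<noteq> 0"
      then have "b < 0" using assms(2) by simp
      \<comment> \<open>the point (s, 1) gives the form the value - c - 2\<close>
      define s where "s = (c + 1) / (- b)"
      have "b * s = - (c + 1)" "0 \<le> s"
        using \<open>b < 0\<close> c by (auto simp: s_def divide_simps)
      moreover have "0 \<le> 2 * (b * s) + c"
        using assms(1)[of s 1] True \<open>0 \<le> s\<close> by (simp add: mult.assoc)
      ultimately show False using c by linarith
    qed
    then show ?thesis using True by simp
  next
    case False
    with a have "0 < a" by simp
    have "0 \<le> a * (- b)\<^sup>2 + 2 * b * (- b) * a + c * a\<^sup>2"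
      using assms(1)[of "- b" a] assms(2) a by simp
    also have "\<dots> = a * (a * c - b\<^sup>2)" by algebra
    finally show ?thesis using \<open>0 < a\<close> by (simp add: zero_le_mult_iff)
  qed
qed

text \<open>If an off-diagonal entry vanishes, then so do all subtracted terms. Otherwise, after scaling the
  off-diagonal entries to 1, the determinant becomes
  \<open>u v w + 2 - u - v - w = (1 - u) (1 - v) + (1 - w) (1 - u v)\<close> with \<open>u, v, w \<in> [0, 1]\<close>.\<close>

lemma det_nonneg_of_dominant_products:
  fixes p q r x y z :: real
  assumes nn: "0 \<le> p" "0 \<le> q" "0 \<le> r" "0 \<le> x" "0 \<le> y" "0 \<le> z"
    and minors: "p * q \<le> x\<^sup>2" "p * r \<le> y\<^sup>2" "q * r \<le> z\<^sup>2"
    and dom: "p * z \<le> x * y" "q * y \<le> x * z" "r * x \<le> y * z"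
  shows "0 \<le> p * q * r + 2 * x * y * z - p * z\<^sup>2 - q * y\<^sup>2 - r * x\<^sup>2"
proof (cases "x = 0 \<or> y = 0 \<or> z = 0")
  case True
  have "p * z\<^sup>2 \<le> x * y * z" "q * y\<^sup>2 \<le> x * y * z" "r * x\<^sup>2 \<le> x * y * z"
    using mult_right_mono[OF dom(1) nn(6)] mult_right_mono[OF dom(2) nn(5)]
      mult_right_mono[OF dom(3) nn(4)] by (simp_all add: power2_eq_square ac_simps)
  moreover have "0 \<le> p * q * r" using nn by simp
  moreover have "x * y * z = 0" "2 * x * y * z = 0" using True by auto
  ultimately show ?thesis by linarith
next
  case False
  then have pos: "0 < x" "0 < y" "0 < z" using nn by auto
  define u v w where "u = p * z / (x * y)" and "v = q * y / (x * z)" and "w = r * x / (y * z)"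
  have uvw: "0 \<le> u" "u \<le> 1" "0 \<le> v" "v \<le> 1" "0 \<le> w" "w \<le> 1"
    unfolding u_def v_def w_def using pos nn dom by auto
  have p: "p = u * (x * y) / z" "q = v * (x * z) / y" "r = w * (y * z) / x"
    unfolding u_def v_def w_def using pos by auto
  have "p * q * r + 2 * x * y * z - p * z\<^sup>2 - q * y\<^sup>2 - r * x\<^sup>2
      = x * y * z * ((1 - u) * (1 - v) + (1 - w) * (1 - u * v))"
    unfolding p using pos by (simp add: field_simps power2_eq_square)
  moreover have "u * v \<le> 1" using uvw by (simp add: mult_le_one)
  ultimately show ?thesis using pos uvw by simp
qed

text \<open>For the converse, positivity on the quadrant alone has to imply that the determinant is
  nonnegative. Either some row \<open>i\<close> has \<open>P\<^sub>i\<^sub>j P\<^sub>i\<^sub>k < P\<^sub>i\<^sub>i P\<^sub>j\<^sub>k\<close>; then the binary form of that row has a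
  negative mixed coefficient, and \<open>copositive_discriminant\<close> applies. Or no row does, and then
  \<open>det_nonneg_of_dominant_products\<close> applies.\<close>

lemma at_most_one_pos_eigenvalue_iff_reverse_CS:
  fixes A :: "real ^ 3 ^ 3"
  assumes sym: "transpose A = A" and nn: "\<And>i j. 0 \<le> A$i$j"
  shows "at_most_one_pos_eigenvalue A \<longleftrightarrow> reverse_CS A"
proof
  assume "at_most_one_pos_eigenvalue A"
  then have D: "0 \<le> det A" and m: "minor_sum A \<le> 0"
    using at_most_one_pos_eigenvalue_iff_signs[OF sym] nn by auto
  show "reverse_CS A"
    unfolding reverse_CS_def
  proof (intro allI impI)
    fix i j k :: 3 and s t :: real
    assume ijk: "{i, j, k} = UNIV"
    show "A$i$i * (A$j$j * s\<^sup>2 + 2 * A$j$k * s * t + A$k$k * t\<^sup>2) \<le> (A$i$j * s + A$i$k * t)\<^sup>2"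
      using D m nn[of i i] unfolding symmetric_invariants[OF sym ijk]
      by (intro signs_imp_reverse_CS_real)
  qed
next
  assume rcs: "reverse_CS A"
  have s: "A$p$q = A$q$p" for p q
    using arg_cong[OF sym, of "\<lambda>M. M $ p $ q"] by (simp add: transpose_def)
  have minor: "A$i$i * A$j$j \<le> (A$i$j)\<^sup>2" if "i \<noteq> j" for i j
  proof -
    obtain k where "{i, j, k} = UNIV"
      using \<open>i \<noteq> j\<close> by (rule ex_third_index)
    then show ?thesis using rcs[unfolded reverse_CS_def, rule_format, of i j k 1 0] by simp
  qed
  have D: "0 \<le> det A" if ijk: "{i, j, k} = UNIV" and le: "A$i$j * A$i$k \<le> A$i$i * A$j$k"
      and pos: "A$i$i \<noteq> 0" for i j k
  proof -
    define a b c where "a = (A$i$j)\<^sup>2 - A$i$i * A$j$j" and "b = A$i$j * A$i$k - A$i$i * A$j$k"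
      and "c = (A$i$k)\<^sup>2 - A$i$i * A$k$k"
    have "0 \<le> a * s\<^sup>2 + 2 * b * s * t + c * t\<^sup>2" if "0 \<le> s" "0 \<le> t" for s t
    proof -
      have "a * s\<^sup>2 + 2 * b * s * t + c * t\<^sup>2 = (A$i$j * s + A$i$k * t)\<^sup>2
          - A$i$i * (A$j$j * s\<^sup>2 + 2 * A$j$k * s * t + A$k$k * t\<^sup>2)"
        unfolding a_def b_def c_def by algebra
      then show ?thesis
        using rcs[unfolded reverse_CS_def, rule_format, OF ijk that] by simp
    qed
    then have "b\<^sup>2 \<le> a * c"
      using le by (intro copositive_discriminant) (auto simp: b_def)
    moreover have "a * c - b\<^sup>2 = A$i$i * det A"
      unfolding symmetric_invariants[OF sym ijk] a_def b_def c_def by algebra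
    ultimately have "0 \<le> A$i$i * det A" by linarith
    moreover have "0 < A$i$i" using pos nn[of i i] by simp
    ultimately show ?thesis by (simp add: zero_le_mult_iff)
  qed
  have "0 \<le> det A"
  proof (cases "\<exists>i j k. {i, j, k} = UNIV \<and> A$i$j * A$i$k < A$i$i * A$j$k")
    case True
    then obtain i j k where *: "{i, j, k} = UNIV" "A$i$j * A$i$k < A$i$i * A$j$k" by blast
    moreover have "A$i$i \<noteq> 0"
      using *(2) nn[of i j] nn[of i k] by (metis mult_zero_left mult_nonneg_nonneg not_less)
    ultimately show ?thesis using D[of i j k] by simp
  next
    case False
    then have dom: "A$i$i * A$j$k \<le> A$i$j * A$i$k" if "{i, j, k} = UNIV" for i j k
      using that by (meson not_le)
    have "0 \<le> A$1$1 * A$2$2 * A$3$3 + 2 * A$1$2 * A$1$3 * A$2$3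
      - A$1$1 * (A$2$3)\<^sup>2 - A$2$2 * (A$1$3)\<^sup>2 - A$3$3 * (A$1$2)\<^sup>2"
      using nn minor dom[of 1 2 3] dom[of 2 1 3] dom[of 3 1 2]
      by (intro det_nonneg_of_dominant_products) (auto simp: triple_3 s[of 2 1] s[of 3 1] s[of 3 2])
    then show ?thesis using symmetric_invariants(1)[OF sym, of 1 2 3] by (simp add: triple_3)
  qed
  moreover have "minor_sum A \<le> 0"
    using minor[of 1 2] minor[of 1 3] minor[of 2 3] symmetric_invariants(2)[OF sym, of 1 2 3]
    by (simp add: triple_3)
  ultimately show "at_most_one_pos_eigenvalue A"
    using at_most_one_pos_eigenvalue_iff_signs[OF sym] nn by simp
qed

section \<open>Logarithms of Lorentzian matrices with a fixed support\<close>

lemma finite_simplex_pts: "finite (simplex_pts d)"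
proof (rule finite_subset)
  show "simplex_pts d \<subseteq> vec_lambda ` (UNIV \<rightarrow>\<^sub>E {..d})"
  proof
    fix \<alpha> assume "\<alpha> \<in> simplex_pts d"
    then have "\<alpha> $ i \<le> d" for i
      using member_le_sum[of i UNIV "\<lambda>i. \<alpha> $ i"] by (auto simp: simplex_pts_def)
    then show "\<alpha> \<in> vec_lambda ` (UNIV \<rightarrow>\<^sub>E {..d})"
      by (intro image_eqI[of _ _ "vec_nth \<alpha>"]) auto
  qed
  show "finite (vec_lambda ` (UNIV \<rightarrow>\<^sub>E {..d}) :: mindex set)"
    by (intro finite_imageI finite_PiE) auto
qed

lemma finite_M_convex: "M_convex d J \<Longrightarrow> finite J"
  using finite_simplex_pts finite_subset unfolding M_convex_def by blast

text \<open>Exchange between \<open>2 e\<^sub>i\<close> and \<open>2 e\<^sub>j\<close> has only one possible outcome.\<close>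

lemma M_convex_two_squares:
  assumes M: "M_convex 2 T" and "std i + std i \<in> T" "std j + std j \<in> T" "i \<noteq> j"
  shows "std i + std j \<in> T"
proof -
  have "(std j + std j) $ i < (std i + std i) $ i"
    using \<open>i \<noteq> j\<close> by (simp add: axis_def)
  then obtain m where m: "(std i + std i) $ m < (std j + std j) $ m"
    "std i + std i - std i + std m \<in> T"
    using M assms(2,3) unfolding M_convex_def by blast
  have "m = j" using m(1) by (auto simp: axis_def split: if_splits)
  then show ?thesis using m(2) by simp
qed

text \<open>Exchanging \<open>e\<^sub>i\<close> between \<open>2 e\<^sub>i\<close> and \<open>e\<^sub>j + e\<^sub>k\<close> can bring in \<open>e\<^sub>j\<close> or \<open>e\<^sub>k\<close>; either way the two resulting
  points are \<open>e\<^sub>i + e\<^sub>j\<close> and \<open>e\<^sub>i + e\<^sub>k\<close>.\<close>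

lemma M_convex_square_and_product:
  assumes M: "M_convex 2 T" and ii: "std i + std i \<in> T" and jk: "std j + std k \<in> T"
    and ijk: "{i, j, k} = UNIV"
  shows "std i + std j \<in> T" "std i + std k \<in> T"
proof -
  have ne: "i \<noteq> j" "i \<noteq> k" "j \<noteq> k" using ijk unfolding triple_3 by auto
  have "(std j + std k) $ i < (std i + std i) $ i"
    using ne by (simp add: axis_def)
  then obtain m where m: "(std i + std i) $ m < (std j + std k) $ m"
    "std i + std i - std i + std m \<in> T" "std j + std k - std m + std i \<in> T"
    using M ii jk unfolding M_convex_def by blast
  have "m = j \<or> m = k" using m(1) by (auto simp: axis_def split: if_splits)
  then have "std i + std j \<in> T \<and> std i + std k \<in> T"
    using m(2,3) by (auto simp: add.commute)
  then show "std i + std j \<in> T" "std i + std k \<in> T" by auto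
qed

definition exp_matrix :: "mindex set \<Rightarrow> (mindex \<Rightarrow> real) \<Rightarrow> real ^ 3 ^ 3" where
  "exp_matrix T a = (\<chi> i j. if std i + std j \<in> T then exp (a (std i + std j)) else 0)"

lemma exp_matrix_nth:
  "exp_matrix T a $ i $ j = (if std i + std j \<in> T then exp (a (std i + std j)) else 0)"
  by (simp add: exp_matrix_def)

lemma transpose_exp_matrix: "transpose (exp_matrix T a) = exp_matrix T a"
  by (simp add: transpose_def exp_matrix_nth vec_eq_iff add.commute)

definition lorentz_logs :: "mindex set \<Rightarrow> (mindex \<Rightarrow> real) set" where
  "lorentz_logs T = {a. at_most_one_pos_eigenvalue (exp_matrix T a)}"

text \<open>These two ratios of entries are unchanged when the matrix is rescaled by a positive diagonal
  congruence. In them the reverse Cauchy-Schwarz inequalities have the constant right-hand side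
  \<open>(s + t)\<^sup>2\<close>. The exchange property guarantees that no denominator outside \<open>T\<close> occurs.\<close>

definition square_ratio :: "mindex set \<Rightarrow> (mindex \<Rightarrow> real) \<Rightarrow> 3 \<Rightarrow> 3 \<Rightarrow> real" where
  "square_ratio T a i j = (if std i + std i \<in> T \<and> std j + std j \<in> T
     then exp (a (std i + std i) + a (std j + std j) - 2 * a (std i + std j)) else 0)"

definition mixed_ratio :: "mindex set \<Rightarrow> (mindex \<Rightarrow> real) \<Rightarrow> 3 \<Rightarrow> 3 \<Rightarrow> 3 \<Rightarrow> real" where
  "mixed_ratio T a i j k = (if std i + std i \<in> T \<and> std j + std k \<in> T
     then exp (a (std i + std i) + a (std j + std k) - a (std i + std j) - a (std i + std k)) else 0)"

text \<open>Substituting \<open>s / P\<^sub>i\<^sub>j\<close> and \<open>t / P\<^sub>i\<^sub>k\<close> into the reverse Cauchy-Schwarz inequalities makes them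
  scale-invariant. If one of these entries vanishes, then by the exchange property so do all ratios
  attached to it, and the corresponding variable may be replaced by 0.\<close>

lemma lorentz_logs_iff:
  assumes T: "T = {} \<or> M_convex 2 T"
  shows "a \<in> lorentz_logs T \<longleftrightarrow> (\<forall>i j k s t. {i, j, k} = UNIV \<longrightarrow> 0 \<le> s \<longrightarrow> 0 \<le> t \<longrightarrow>
    square_ratio T a i j * s\<^sup>2 + 2 * mixed_ratio T a i j k * s * t + square_ratio T a i k * t\<^sup>2
      \<le> (s + t)\<^sup>2)"
    (is "_ \<longleftrightarrow> ?R")
proof -
  define P where "P = exp_matrix T a"
  have P: "P$i$j = (if std i + std j \<in> T then exp (a (std i + std j)) else 0)" for i j
    unfolding P_def by (rule exp_matrix_nth)
  have P_nn: "0 \<le> P$i$j" for i j unfolding P by simp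
  have sq: "P$i$i * P$j$j = square_ratio T a i j * (P$i$j)\<^sup>2" if "i \<noteq> j" for i j
    using M_convex_two_squares[of T i j] that T
    by (auto simp: P square_ratio_def simp flip: exp_add exp_of_nat_mult exp_double)
  have mx: "P$i$i * P$j$k = mixed_ratio T a i j k * P$i$j * P$i$k" if "{i, j, k} = UNIV" for i j k
    using M_convex_square_and_product[of T i j k] that T
    by (auto simp: P mixed_ratio_def simp flip: exp_add)
  have degenerate: "square_ratio T a i j = 0" "mixed_ratio T a i j k = 0"
      "mixed_ratio T a i k j = 0"
    if "P$i$j = 0" "{i, j, k} = UNIV" for i j k
  proof -
    have "std i + std j \<notin> T" using that(1) by (auto simp: P split: if_splits)
    moreover have "{i, k, j} = UNIV" using that(2) by (simp add: insert_commute)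
    ultimately show "square_ratio T a i j = 0" "mixed_ratio T a i j k = 0"
      "mixed_ratio T a i k j = 0"
      using M_convex_two_squares[of T i j] M_convex_square_and_product[of T i j k]
        M_convex_square_and_product[of T i k j] that(2) T
      by (auto simp: square_ratio_def mixed_ratio_def triple_3)
  qed
  have scaled: "P$i$i * (P$j$j * s\<^sup>2 + 2 * P$j$k * s * t + P$k$k * t\<^sup>2)
      = square_ratio T a i j * (P$i$j * s)\<^sup>2
        + 2 * mixed_ratio T a i j k * (P$i$j * s) * (P$i$k * t) + square_ratio T a i k * (P$i$k * t)\<^sup>2"
    if "{i, j, k} = UNIV" for i j k s t
  proof -
    have "i \<noteq> j" "i \<noteq> k" using that by (auto simp: triple_3)
    show ?thesis using sq[OF \<open>i \<noteq> j\<close>] sq[OF \<open>i \<noteq> k\<close>] mx[OF that] by algebra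
  qed
  have "a \<in> lorentz_logs T \<longleftrightarrow> reverse_CS P"
    unfolding lorentz_logs_def P_def[symmetric] mem_Collect_eq
    by (rule at_most_one_pos_eigenvalue_iff_reverse_CS)
      (auto simp: P_nn, simp add: P_def transpose_exp_matrix)
  also have "\<dots> \<longleftrightarrow> ?R"
  proof
    assume R: ?R
    show "reverse_CS P"
      unfolding reverse_CS_def
    proof (intro allI impI)
      fix i j k :: 3 and s t :: real
      assume ijk: "{i, j, k} = UNIV" and st: "0 \<le> s" "0 \<le> t"
      show "P$i$i * (P$j$j * s\<^sup>2 + 2 * P$j$k * s * t + P$k$k * t\<^sup>2) \<le> (P$i$j * s + P$i$k * t)\<^sup>2"
        unfolding scaled[OF ijk] using R ijk st P_nn by simp
    qed
  next
    assume rcs: "reverse_CS P"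
    show ?R
    proof (intro allI impI)
      fix i j k :: 3 and s t :: real
      assume ijk: "{i, j, k} = UNIV" and st: "0 \<le> s" "0 \<le> t"
      have ikj: "{i, k, j} = UNIV" using ijk by (simp add: insert_commute)
      have unscaled: "square_ratio T a i j * (P$i$j * s)\<^sup>2
        + 2 * mixed_ratio T a i j k * (P$i$j * s) * (P$i$k * t) + square_ratio T a i k * (P$i$k * t)\<^sup>2
        \<le> (P$i$j * s + P$i$k * t)\<^sup>2" if "0 \<le> s" "0 \<le> t" for s t
        using rcs ijk that unfolding reverse_CS_def scaled[OF ijk, symmetric] by blast
      \<comment> \<open>by degenerate, a variable whose entry vanishes does not contribute\<close>
      define s' t' where "s' = (if P$i$j = 0 then 0 else s)" and "t' = (if P$i$k = 0 then 0 else t)"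
      have st': "0 \<le> s'" "s' \<le> s" "0 \<le> t'" "t' \<le> t" using st by (auto simp: s'_def t'_def)
      have "square_ratio T a i j * s\<^sup>2 + 2 * mixed_ratio T a i j k * s * t + square_ratio T a i k * t\<^sup>2
          = square_ratio T a i j * s'\<^sup>2 + 2 * mixed_ratio T a i j k * s' * t'
            + square_ratio T a i k * t'\<^sup>2"
        using degenerate[OF _ ijk] degenerate[OF _ ikj] by (auto simp: s'_def t'_def)
      also have "\<dots> \<le> (s' + t')\<^sup>2"
        using unscaled[of "s' / P$i$j" "t' / P$i$k"] st' P_nn[of i j] P_nn[of i k]
        by (auto simp: s'_def t'_def)
      also have "\<dots> \<le> (s + t)\<^sup>2" using st' by (intro power_mono) auto
      finally show "square_ratio T a i j * s\<^sup>2 + 2 * mixed_ratio T a i j k * s * t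
        + square_ratio T a i k * t\<^sup>2 \<le> (s + t)\<^sup>2" .
    qed
  qed
  finally show ?thesis .
qed

lemma lorentz_logs_antimono:
  assumes T: "T = {} \<or> M_convex 2 T" and b: "b \<in> lorentz_logs T"
    and sq: "\<And>i j. i \<noteq> j \<Longrightarrow> square_ratio T a i j \<le> square_ratio T b i j"
    and mx: "\<And>i j k. {i, j, k} = UNIV \<Longrightarrow> mixed_ratio T a i j k \<le> mixed_ratio T b i j k"
  shows "a \<in> lorentz_logs T"
  unfolding lorentz_logs_iff[OF T]
proof (intro allI impI)
  fix i j k :: 3 and s t :: real
  assume ijk: "{i, j, k} = UNIV" and st: "0 \<le> s" "0 \<le> t"
  then have "square_ratio T a i j * s\<^sup>2 + 2 * mixed_ratio T a i j k * s * t + square_ratio T a i k * t\<^sup>2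
    \<le> square_ratio T b i j * s\<^sup>2 + 2 * mixed_ratio T b i j k * s * t + square_ratio T b i k * t\<^sup>2"
    using sq[of i j] sq[of i k] mx[OF ijk]
    by (intro add_mono mult_right_mono) (auto simp: triple_3)
  also have "\<dots> \<le> (s + t)\<^sup>2" using b ijk st unfolding lorentz_logs_iff[OF T] by blast
  finally show "square_ratio T a i j * s\<^sup>2 + 2 * mixed_ratio T a i j k * s * t
    + square_ratio T a i k * t\<^sup>2 \<le> (s + t)\<^sup>2" .
qed

text \<open>The matrix whose entries on \<open>T\<close> are all 1: every ratio is 0 or 1.\<close>

lemma zero_in_lorentz_logs:
  assumes T: "T = {} \<or> M_convex 2 T"
  shows "(\<lambda>_. 0) \<in> lorentz_logs T"
  unfolding lorentz_logs_iff[OF T]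
proof (intro allI impI)
  fix i j k :: 3 and s t :: real
  assume st: "0 \<le> s" "0 \<le> t"
  have "square_ratio T (\<lambda>_. 0) i j * s\<^sup>2 + 2 * mixed_ratio T (\<lambda>_. 0) i j k * s * t
      + square_ratio T (\<lambda>_. 0) i k * t\<^sup>2 \<le> 1 * s\<^sup>2 + 2 * 1 * s * t + 1 * t\<^sup>2"
    using st by (intro add_mono mult_right_mono mult_left_mono)
      (auto simp: square_ratio_def mixed_ratio_def)
  also have "\<dots> = (s + t)\<^sup>2" by algebra
  finally show "square_ratio T (\<lambda>_. 0) i j * s\<^sup>2 + 2 * mixed_ratio T (\<lambda>_. 0) i j k * s * t
      + square_ratio T (\<lambda>_. 0) i k * t\<^sup>2 \<le> (s + t)\<^sup>2" .
qed

lemma exp_combination_le: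
  fixes x y u v :: real
  assumes "0 \<le> u" "0 \<le> v" "u + v = 1"
  shows "exp (u * x + v * y) \<le> u * exp x + v * exp y"
  using convex_onD[OF exp_convex, of v x y] assms by (simp add: eq_diff_eq[symmetric])

text \<open>In logarithmic coordinates each condition bounds a nonnegative combination of exponentials of
  linear functionals by a constant, so it defines a convex set.\<close>

lemma lorentz_logs_convex:
  assumes T: "T = {} \<or> M_convex 2 T" and a: "a \<in> lorentz_logs T" and b: "b \<in> lorentz_logs T"
    and uv: "0 \<le> u" "0 \<le> v" "u + v = 1"
  shows "(\<lambda>\<gamma>. u * a \<gamma> + v * b \<gamma>) \<in> lorentz_logs T"
  unfolding lorentz_logs_iff[OF T]
proof (intro allI impI)
  fix i j k :: 3 and s t :: real
  assume ijk: "{i, j, k} = UNIV" and st: "0 \<le> s" "0 \<le> t"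
  let ?c = "\<lambda>\<gamma>. u * a \<gamma> + v * b \<gamma>"
  define Q where "Q c = square_ratio T c i j * s\<^sup>2 + 2 * mixed_ratio T c i j k * s * t
    + square_ratio T c i k * t\<^sup>2" for c
  have sq: "square_ratio T ?c p q \<le> u * square_ratio T a p q + v * square_ratio T b p q" for p q
    using exp_combination_le[OF uv, of
        "a (std p + std p) + a (std q + std q) - 2 * a (std p + std q)"
        "b (std p + std p) + b (std q + std q) - 2 * b (std p + std q)"]
    by (simp add: square_ratio_def algebra_simps)
  have mx: "mixed_ratio T ?c i j k \<le> u * mixed_ratio T a i j k + v * mixed_ratio T b i j k"
    using exp_combination_le[OF uv, of
        "a (std i + std i) + a (std j + std k) - a (std i + std j) - a (std i + std k)"
        "b (std i + std i) + b (std j + std k) - b (std i + std j) - b (std i + std k)"]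
    by (simp add: mixed_ratio_def algebra_simps)
  have "Q ?c \<le> (u * square_ratio T a i j + v * square_ratio T b i j) * s\<^sup>2
      + 2 * (u * mixed_ratio T a i j k + v * mixed_ratio T b i j k) * s * t
      + (u * square_ratio T a i k + v * square_ratio T b i k) * t\<^sup>2"
    unfolding Q_def using st sq mx by (intro add_mono mult_right_mono) auto
  also have "\<dots> = u * Q a + v * Q b" unfolding Q_def by algebra
  also have "\<dots> \<le> u * (s + t)\<^sup>2 + v * (s + t)\<^sup>2"
    using a b ijk st uv unfolding lorentz_logs_iff[OF T] Q_def
    by (intro add_mono mult_left_mono) auto
  also have "\<dots> = (s + t)\<^sup>2" using uv(3) by (simp flip: distrib_right)
  finally show "square_ratio T ?c i j * s\<^sup>2 + 2 * mixed_ratio T ?c i j k * s * t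
    + square_ratio T ?c i k * t\<^sup>2 \<le> (s + t)\<^sup>2" unfolding Q_def .
qed

section \<open>Local generators\<close>

definition pairing :: "mindex set \<Rightarrow> (mindex \<Rightarrow> real) \<Rightarrow> (mindex \<Rightarrow> real) \<Rightarrow> real" where
  "pairing T u a = (\<Sum>\<gamma>\<in>T. u \<gamma> * a \<gamma>)"

definition square_product_generator :: "3 \<Rightarrow> 3 \<Rightarrow> 3 \<Rightarrow> mindex \<Rightarrow> real" where
  "square_product_generator i j k = (\<lambda>\<gamma>. basis_vec (std i + std i) \<gamma> + basis_vec (std j + std k) \<gamma>
     - basis_vec (std i + std j) \<gamma> - basis_vec (std i + std k) \<gamma>)"

definition two_squares_generator :: "3 \<Rightarrow> 3 \<Rightarrow> mindex \<Rightarrow> real" where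
  "two_squares_generator i j = (\<lambda>\<gamma>. basis_vec (std i + std i) \<gamma> + basis_vec (std j + std j) \<gamma>
     - 2 * basis_vec (std i + std j) \<gamma>)"

lemma mem_local_generators:
  "u \<in> local_generators T \<longleftrightarrow>
     (\<exists>i j k. {i, j, k} = UNIV \<and> std i + std i \<in> T \<and> std j + std k \<in> T \<and> std i + std j \<in> T
        \<and> std i + std k \<in> T \<and> u = square_product_generator i j k) \<or>
     (\<exists>i j. i \<noteq> j \<and> T = {std i + std i, std i + std j, std j + std j} \<and> u = two_squares_generator i j)"
  unfolding local_generators_def square_product_generator_def two_squares_generator_def
  by (simp only: Un_iff mem_Collect_eq)

lemma sum_basis_vec:
  assumes "finite T" "x \<in> T"
  shows "(\<Sum>\<gamma>\<in>T. basis_vec x \<gamma> * a \<gamma>) = a x"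
proof -
  have "(\<Sum>\<gamma>\<in>T. basis_vec x \<gamma> * a \<gamma>) = (\<Sum>\<gamma>\<in>T. if \<gamma> = x then a \<gamma> else 0)"
    by (intro sum.cong) (auto simp: indicator_def)
  also have "\<dots> = a x" using assms by (simp only: sum.delta if_True)
  finally show ?thesis .
qed

lemma pairing_square_product:
  assumes "finite T" "std i + std i \<in> T" "std j + std k \<in> T" "std i + std j \<in> T" "std i + std k \<in> T"
  shows "pairing T (square_product_generator i j k) a
    = a (std i + std i) + a (std j + std k) - a (std i + std j) - a (std i + std k)"
  by (simp only: pairing_def square_product_generator_def distrib_right left_diff_distrib
      sum.distrib sum_subtractf sum_basis_vec[OF assms(1)] assms(2-))

lemma pairing_two_squares:
  assumes "finite T" "std i + std i \<in> T" "std i + std j \<in> T" "std j + std j \<in> T"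
  shows "pairing T (two_squares_generator i j) a
    = a (std i + std i) + a (std j + std j) - 2 * a (std i + std j)"
  by (simp only: pairing_def two_squares_generator_def distrib_right left_diff_distrib mult.assoc
      sum.distrib sum_subtractf sum_distrib_left[symmetric] sum_basis_vec[OF assms(1)] assms(2-))

text \<open>Each mixed ratio is the exponential of a generator value, and each square ratio is the exponential
  of one such value (when \<open>T\<close> is \<open>{2 e\<^sub>i, e\<^sub>i + e\<^sub>j, 2 e\<^sub>j}\<close>) or of a sum of two; the conditions on the
  ratios are upper bounds. In particular membership depends on the generator values alone: a
  matrix with the generator ratios of a Lorentzian matrix is Lorentzian.\<close>

lemma lorentz_logs_downward_closed:
  assumes T: "T = {} \<or> M_convex 2 T" and T2: "T \<subseteq> {std i + std j | i j. True}"
    and b: "b \<in> lorentz_logs T"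
    and le: "\<And>u. u \<in> local_generators T \<Longrightarrow> pairing T u a \<le> pairing T u b"
  shows "a \<in> lorentz_logs T"
proof (rule lorentz_logs_antimono[OF T b])
  have fin: "finite T" using T finite_M_convex by auto
  note two = M_convex_two_squares and prod = M_convex_square_and_product
  have gen: "a (std i + std i) + a (std j + std k) - a (std i + std j) - a (std i + std k)
      \<le> b (std i + std i) + b (std j + std k) - b (std i + std j) - b (std i + std k)"
    if "{i, j, k} = UNIV" "std i + std i \<in> T" "std j + std k \<in> T" for i j k
  proof -
    have M: "M_convex 2 T" using T that by auto
    note * = that(2,3) prod[OF M that(2,3,1)]
    have "square_product_generator i j k \<in> local_generators T"
      using * that(1) unfolding mem_local_generators by blast
    from le[OF this] show ?thesis using pairing_square_product[OF fin *] by simp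
  qed
  show "mixed_ratio T a i j k \<le> mixed_ratio T b i j k" if "{i, j, k} = UNIV" for i j k
    using gen[OF that] by (simp add: mixed_ratio_def)
  show "square_ratio T a i j \<le> square_ratio T b i j" if "i \<noteq> j" for i j
  proof (cases "std i + std i \<in> T \<and> std j + std j \<in> T")
    case True
    then have M: "M_convex 2 T" using T by auto
    have ij: "std i + std j \<in> T" using two[OF M] True that by blast
    obtain k where ijk: "{i, j, k} = UNIV" using \<open>i \<noteq> j\<close> by (rule ex_third_index)
    then have jik: "{j, i, k} = UNIV" and ne: "i \<noteq> k" "j \<noteq> k"
      by (auto simp: triple_3)
    have "a (std i + std i) + a (std j + std j) - 2 * a (std i + std j)
      \<le> b (std i + std i) + b (std j + std j) - 2 * b (std i + std j)"
    proof (cases "std i + std k \<in> T")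
      case ik: True
      have "std j + std k \<in> T" using prod(2)[OF M _ ik jik] True by blast
      then show ?thesis using gen[OF ijk] gen[OF jik] ik True by (simp add: add.commute)
    next
      case ik: False
      have "std j + std k \<notin> T" using prod(2)[OF M _ _ ijk] True ik by blast
      moreover have "std k + std k \<notin> T" using two[OF M _ _ ne(1)] True ik by blast
      ultimately have *: "std p + std q \<in> {std i + std i, std i + std j, std j + std j}"
        if "std p + std q \<in> T" for p q
      proof -
        have "p \<in> {i, j, k}" "q \<in> {i, j, k}" using ijk by blast+
        then show ?thesis
          using \<open>std j + std k \<notin> T\<close> \<open>std k + std k \<notin> T\<close> that ik by (auto simp: add.commute)
      qed
      then have "T \<subseteq> {std i + std i, std i + std j, std j + std j}"
        using T2 * by blast
      \<comment> \<open>no point of T involves k, so T carries a generator on three points\<close>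
      then have "T = {std i + std i, std i + std j, std j + std j}"
        using True ij by blast
      then have "two_squares_generator i j \<in> local_generators T"
        using that unfolding mem_local_generators by blast
      from le[OF this] show ?thesis
        using pairing_two_squares[OF fin _ ij] True by simp
    qed
    then show ?thesis using True by (simp add: square_ratio_def)
  qed (auto simp: square_ratio_def)
qed

text \<open>The coordinate at \<open>2 e\<^sub>i\<close> belongs to a single generator. Hence the generator values of a vector can be
  changed one at a time.\<close>

lemma local_generator_pivot:
  assumes u: "u \<in> local_generators T"
  shows "\<exists>\<gamma>\<in>T. u \<gamma> = 1 \<and> (\<forall>v\<in>local_generators T. v \<noteq> u \<longrightarrow> v \<gamma> = 0)"
proof -
  have clash: False
    if "{i, j, k} = UNIV" "std i + std i \<in> T" "std j + std k \<in> T" "std i + std j \<in> T"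
      "std i + std k \<in> T" "T = {std p + std p, std p + std q, std q + std q}" for i j k p q :: 3
  proof -
    have "{std i + std i, std j + std k, std i + std j, std i + std k} \<subseteq> T" using that by blast
    then have "card {std i + std i, std j + std k, std i + std j, std i + std k} \<le> card T"
      using that(6) by (intro card_mono) auto
    moreover have "distinct [std i + std i, std j + std k, std i + std j, std i + std k]"
      using that(1) unfolding triple_3 distinct.simps list.set insert_iff std_add_eq_iff by auto
    then have "card {std i + std i, std j + std k, std i + std j, std i + std k} = 4"
      using distinct_card by fastforce
    moreover have "card T \<le> 3"
      using that(6) card_length[of "[std p + std p, std p + std q, std q + std q]"] by simp
    ultimately show False by simp
  qed
  from u consider
    (product) i j k where "{i, j, k} = UNIV" "std i + std i \<in> T" "std j + std k \<in> T"
      "std i + std j \<in> T" "std i + std k \<in> T" "u = square_product_generator i j k"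
  | (squares) i j where "i \<noteq> j" "T = {std i + std i, std i + std j, std j + std j}"
      "u = two_squares_generator i j"
    unfolding mem_local_generators by blast
  then show ?thesis
  proof cases
    case product
    show ?thesis
    proof (intro bexI[of _ "std i + std i"] conjI ballI impI)
      show "u (std i + std i) = 1"
        using product(1) by (simp add: product(6) square_product_generator_def indicator_def triple_3 std_add_eq_iff axis_eq_axis del: One_nat_def)
      fix v assume v: "v \<in> local_generators T" "v \<noteq> u"
      then obtain p q r where pqr: "{p, q, r} = UNIV" "v = square_product_generator p q r"
        using clash[OF product(1-5)] unfolding mem_local_generators by blast
      have "p \<noteq> i"
      proof
        assume "p = i"
        then have "(q = j \<and> r = k) \<or> (q = k \<and> r = j)"
        proof -
          have "q \<in> {i, j, k}" "r \<in> {i, j, k}" using product(1) by blast+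
          then show ?thesis using \<open>p = i\<close> pqr(1) unfolding triple_3 by auto
        qed
        then have "v = u"
          using \<open>p = i\<close> by (auto simp: pqr(2) product(6) square_product_generator_def add.commute)
        then show False using v by simp
      qed
      then show "v (std i + std i) = 0"
        using pqr(1) by (auto simp: pqr(2) square_product_generator_def indicator_def triple_3 std_add_eq_iff axis_eq_axis simp del: One_nat_def)
    qed (use product in auto)
  next
    case squares
    show ?thesis
    proof (intro bexI[of _ "std i + std i"] conjI ballI impI)
      show "u (std i + std i) = 1"
        using squares(1) by (simp add: squares(3) two_squares_generator_def indicator_def std_add_eq_iff axis_eq_axis del: One_nat_def)
      fix v assume v: "v \<in> local_generators T" "v \<noteq> u"
      then obtain p q where pq: "T = {std p + std p, std p + std q, std q + std q}"
          "v = two_squares_generator p q"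
        using clash squares(2) unfolding mem_local_generators by blast
      have "std p + std p \<in> {std i + std i, std i + std j, std j + std j}"
        "std q + std q \<in> {std i + std i, std i + std j, std j + std j}"
        "std i + std i \<in> {std p + std p, std p + std q, std q + std q}"
        "std j + std j \<in> {std p + std p, std p + std q, std q + std q}"
        using squares(2) pq(1) by blast+
      then have "(p = i \<and> q = j) \<or> (p = j \<and> q = i)"
        using squares(1) by (auto simp: std_add_eq_iff axis_eq_axis simp del: One_nat_def)
      then have "v = u"
        by (auto simp: pq(2) squares(3) two_squares_generator_def add.commute)
      then show "v (std i + std i) = 0" using v by simp
    qed (use squares in auto)
  qed
qed

section \<open>A finite-dimensional Hahn-Banach theorem\<close>

text \<open>The induction step of the Hahn-Banach theorem below. The points of \<open>C\<close> reached from \<open>L\<close> by moving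
  in the directions of \<open>J\<close> and positively in direction \<open>q\<close> bound the new coefficient \<open>t\<close> from
  above, those reached by moving negatively bound it from below. A lower bound never exceeds an
  upper one, since a suitable convex combination of the two points has no \<open>q\<close>-displacement and is
  covered by the old estimate. The point \<open>c\<close> makes both families of bounds nonempty.\<close>

lemma extend_functional_one_coordinate:
  fixes C L :: "('i \<Rightarrow> real) set" and \<phi> :: "('i \<Rightarrow> real) \<Rightarrow> real"
  assumes J: "finite J" "q \<notin> J"
    and C: "\<And>x y u v. x \<in> C \<Longrightarrow> y \<in> C \<Longrightarrow> 0 \<le> u \<Longrightarrow> 0 \<le> v \<Longrightarrow> u + v = 1 \<Longrightarrow>
      (\<lambda>p. u * x p + v * y p) \<in> C"
    and L: "\<And>x y u v. x \<in> L \<Longrightarrow> y \<in> L \<Longrightarrow> (\<lambda>p. u * x p + v * y p) \<in> L"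
    and \<phi>: "\<And>x y u v. \<phi> (\<lambda>p. u * x p + v * y p) = u * \<phi> x + v * \<phi> y"
    and inner: "c \<in> L" "0 < (\<delta>::real)" "c(q := c q + \<delta>) \<in> C" "c(q := c q - \<delta>) \<in> C"
    and bound: "\<And>x z. x \<in> L \<Longrightarrow> z \<in> coord_space J \<Longrightarrow> (\<lambda>p. x p + z p) \<in> C \<Longrightarrow>
      \<phi> x + (\<Sum>p\<in>J. \<mu> p * z p) \<le> M"
  shows "\<exists>t. \<forall>x\<in>L. \<forall>z\<in>coord_space (insert q J). (\<lambda>p. x p + z p) \<in> C \<longrightarrow>
      \<phi> x + (\<Sum>p\<in>insert q J. (\<mu>(q := t)) p * z p) \<le> M"
proof -
  define N where "N z = (\<Sum>p\<in>J. \<mu> p * z p)" for z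
  have N: "N (\<lambda>p. u * z p + v * z' p) = u * N z + v * N z'" for u v z z'
    by (simp add: N_def sum.distrib sum_distrib_left algebra_simps)
  have N_upd: "N (z(q := r)) = N z" for z r
    unfolding N_def using J by (intro sum.cong) auto
  define K where "K = {(x, z). x \<in> L \<and> z \<in> coord_space (insert q J) \<and> (\<lambda>p. x p + z p) \<in> C}"
  define lo where "lo = (\<lambda>(x, z). (\<phi> x + N z - M) / (- z q))"
  define up where "up = (\<lambda>(x, z). (M - \<phi> x - N z) / z q)"
  have le: "lo (x', z') \<le> up (x, z)"
    if xz: "(x, z) \<in> K" "0 < z q" "(x', z') \<in> K" "z' q < 0" for x z x' z'
  proof -
    define D where "D = z q - z' q"
    have D: "0 < D" using xz(2,4) by (simp add: D_def)
    define u v where "u = - z' q / D" and "v = z q / D"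
    have "0 \<le> u" "0 \<le> v"
      using xz(2,4) D by (auto simp: u_def v_def intro!: divide_nonneg_pos divide_nonpos_pos)
    moreover have "u + v = 1" "u * z q + v * z' q = 0"
      using D by (auto simp: u_def v_def D_def simp flip: add_divide_distrib diff_divide_distrib)
    ultimately have uv: "0 \<le> u" "0 \<le> v" "u + v = 1" "u * z q + v * z' q = 0" .
    \<comment> \<open>the weights are chosen so that the q-displacements of the two points cancel\<close>
    define w where "w = (\<lambda>p. u * z p + v * z' p)"
    have "(\<lambda>p. u * (x p + z p) + v * (x' p + z' p)) \<in> C"
      using xz uv by (intro C) (auto simp: K_def)
    moreover have "(\<lambda>p. u * (x p + z p) + v * (x' p + z' p)) = (\<lambda>p. (u * x p + v * x' p) + w p)"
      by (auto simp: w_def algebra_simps)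
    moreover have "w p = 0" if "p \<notin> J" for p
      using xz uv(4) that by (cases "p = q") (auto simp: w_def K_def coord_space_def)
    then have "w \<in> coord_space J" by (simp add: coord_space_def)
    moreover have "(\<lambda>p. u * x p + v * x' p) \<in> L" using xz L by (auto simp: K_def)
    ultimately have "\<phi> (\<lambda>p. u * x p + v * x' p) + N w \<le> M"
      using bound unfolding N_def by fastforce
    then have "u * (\<phi> x + N z) + v * (\<phi> x' + N z') \<le> M"
      unfolding \<phi> w_def N by (simp add: algebra_simps)
    then have "D * (u * (\<phi> x + N z) + v * (\<phi> x' + N z')) \<le> D * M"
      using D by (intro mult_left_mono) auto
    moreover have "D * u = - z' q" "D * v = z q" using D by (auto simp: u_def v_def)
    ultimately have "- z' q * (\<phi> x + N z) + z q * (\<phi> x' + N z') \<le> M * D"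
      by (simp add: distrib_left mult.commute flip: mult.assoc)
    then show ?thesis
      using xz(2,4) unfolding lo_def up_def D_def by (simp add: field_simps)
  qed
  define Lo where "Lo = lo ` {(x, z) \<in> K. z q < 0}"
  define Up where "Up = up ` {(x, z) \<in> K. 0 < z q}"
  have e: "(\<lambda>p. c p + (if p = q then r else 0)) = c(q := c q + r)" for r by auto
  have "(c, \<lambda>p. if p = q then \<delta> else 0) \<in> K" "(c, \<lambda>p. if p = q then - \<delta> else 0) \<in> K"
    using inner e[of \<delta>] e[of "- \<delta>"] by (auto simp: K_def coord_space_def)
  then have ne: "Lo \<noteq> {}" "Up \<noteq> {}" unfolding Lo_def Up_def using inner(2) by fastforce+
  have LU: "l \<le> h" if "l \<in> Lo" "h \<in> Up" for l h
    using that le unfolding Lo_def Up_def by auto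
  define t where "t = Sup Lo"
  have lo_t: "l \<le> t" if "l \<in> Lo" for l
  proof -
    obtain h where "h \<in> Up" using ne by blast
    then have "bdd_above Lo" using LU by (intro bdd_aboveI[of _ h]) auto
    then show ?thesis unfolding t_def using that by (intro cSup_upper)
  qed
  have t_up: "t \<le> h" if "h \<in> Up" for h
    unfolding t_def using that LU ne by (intro cSup_least) auto
  have "\<phi> x + (\<Sum>p\<in>insert q J. (\<mu>(q := t)) p * z p) \<le> M" if xz: "(x, z) \<in> K" for x z
  proof -
    have "(\<Sum>p\<in>J. (\<mu>(q := t)) p * z p) = N z"
      unfolding N_def using J by (intro sum.cong) auto
    then have S: "(\<Sum>p\<in>insert q J. (\<mu>(q := t)) p * z p) = t * z q + N z"
      using J by simp
    consider "z q = 0" | "0 < z q" | "z q < 0" by linarith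
    then show ?thesis
    proof cases
      case 1
      then have "z \<in> coord_space J" using xz by (auto simp: K_def coord_space_def)
      then show ?thesis using bound[of x z] xz 1 unfolding S N_def K_def by simp
    next
      case 2
      then have "up (x, z) \<in> Up" using xz unfolding Up_def by blast
      from t_up[OF this] show ?thesis using 2 unfolding S up_def by (simp add: field_simps)
    next
      case 3
      then have "lo (x, z) \<in> Lo" using xz unfolding Lo_def by blast
      from lo_t[OF this] show ?thesis using 3 unfolding S lo_def by (simp add: field_simps)
    qed
  qed
  then show ?thesis unfolding K_def by blast
qed

text \<open>A form of the Hahn-Banach theorem, with the qualification that \<open>L\<close> meets the interior of \<open>C\<close>.
  The coefficients are found one coordinate at a time for displacements \<open>z\<close> from \<open>L\<close>. Once all
  coordinates are allowed, \<open>z\<close> may be the difference of a point of \<open>C\<close> and an arbitrary point of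
  \<open>L\<close>, and boundedness on the subspace forces the two functionals to agree there.\<close>

lemma bounded_functional_extends:
  fixes C L :: "('i \<Rightarrow> real) set" and lam :: "'i \<Rightarrow> real"
  assumes I: "finite I"
    and C: "\<And>x y u v. x \<in> C \<Longrightarrow> y \<in> C \<Longrightarrow> 0 \<le> u \<Longrightarrow> 0 \<le> v \<Longrightarrow> u + v = 1 \<Longrightarrow>
      (\<lambda>p. u * x p + v * y p) \<in> C"
    and L: "\<And>x y u v. x \<in> L \<Longrightarrow> y \<in> L \<Longrightarrow> (\<lambda>p. u * x p + v * y p) \<in> L"
    and sub: "C \<subseteq> coord_space I" "L \<subseteq> coord_space I"
    and inner: "c \<in> L" "c \<in> C" "0 < \<delta>"
      "\<And>q. q \<in> I \<Longrightarrow> c(q := c q + \<delta>) \<in> C" "\<And>q. q \<in> I \<Longrightarrow> c(q := c q - \<delta>) \<in> C"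
    and bound: "\<And>x. x \<in> L \<Longrightarrow> x \<in> C \<Longrightarrow> (\<Sum>p\<in>I. lam p * x p) \<le> M"
  obtains \<mu> where "\<And>x. x \<in> L \<Longrightarrow> (\<Sum>p\<in>I. \<mu> p * x p) = (\<Sum>p\<in>I. lam p * x p)"
    and "\<And>x. x \<in> C \<Longrightarrow> (\<Sum>p\<in>I. \<mu> p * x p) \<le> M"
proof -
  define \<phi> where "\<phi> x = (\<Sum>p\<in>I. lam p * x p)" for x
  have \<phi>: "\<phi> (\<lambda>p. u * x p + v * y p) = u * \<phi> x + v * \<phi> y" for u v x y
    by (simp add: \<phi>_def sum.distrib sum_distrib_left algebra_simps)
  have "\<exists>\<mu>. \<forall>x\<in>L. \<forall>z\<in>coord_space J. (\<lambda>p. x p + z p) \<in> C \<longrightarrow> \<phi> x + (\<Sum>p\<in>J. \<mu> p * z p) \<le> M"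
    if "J \<subseteq> I" for J
    using finite_subset[OF that I] that
  proof (induction J rule: finite_induct)
    case empty
    then show ?case
      using bound unfolding \<phi>_def coord_space_def by (auto simp flip: fun_eq_iff)
  next
    case (insert q J)
    then obtain \<mu> where "\<forall>x\<in>L. \<forall>z\<in>coord_space J. (\<lambda>p. x p + z p) \<in> C \<longrightarrow>
      \<phi> x + (\<Sum>p\<in>J. \<mu> p * z p) \<le> M" by auto
    then have "\<exists>t. \<forall>x\<in>L. \<forall>z\<in>coord_space (insert q J). (\<lambda>p. x p + z p) \<in> C \<longrightarrow>
      \<phi> x + (\<Sum>p\<in>insert q J. (\<mu>(q := t)) p * z p) \<le> M"
      using insert.hyps insert.prems inner
      by (intro extend_functional_one_coordinate C L \<phi>) auto
    then show ?case by blast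
  qed
  from this[OF subset_refl] obtain \<mu> where
    \<mu>: "\<And>x z. x \<in> L \<Longrightarrow> z \<in> coord_space I \<Longrightarrow> (\<lambda>p. x p + z p) \<in> C \<Longrightarrow>
      \<phi> x + (\<Sum>p\<in>I. \<mu> p * z p) \<le> M" by blast
  have key: "\<phi> y + (\<Sum>p\<in>I. \<mu> p * x p) - (\<Sum>p\<in>I. \<mu> p * y p) \<le> M" if "y \<in> L" "x \<in> C" for x y
  proof -
    have "(\<lambda>p. x p - y p) \<in> coord_space I"
      using that sub unfolding coord_space_def by fastforce
    from \<mu>[OF that(1) this] that(2) show ?thesis
      by (simp add: sum_subtractf algebra_simps)
  qed
  have eq: "(\<Sum>p\<in>I. \<mu> p * y p) = \<phi> y" if y: "y \<in> L" for y
  proof (rule ccontr)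
    define D K where "D = \<phi> y - (\<Sum>p\<in>I. \<mu> p * y p)" and "K = M - (\<Sum>p\<in>I. \<mu> p * c p)"
    assume "(\<Sum>p\<in>I. \<mu> p * y p) \<noteq> \<phi> y"
    then have "D \<noteq> 0" by (simp add: D_def)
    \<comment> \<open>on the line through y the difference D would be unbounded; this multiple already exceeds K\<close>
    define r where "r = (K + 1) / D"
    have "(\<lambda>p. r * y p + 0 * y p) \<in> L" using L[OF y y] .
    from key[OF this inner(2)] have "r * D \<le> K"
      unfolding \<phi> D_def K_def by (simp add: algebra_simps sum_distrib_left)
    then show False using \<open>D \<noteq> 0\<close> by (simp add: r_def)
  qed
  show thesis
  proof (rule that)
    show "(\<Sum>p\<in>I. \<mu> p * x p) = (\<Sum>p\<in>I. lam p * x p)" if "x \<in> L" for x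
      using eq[OF that] by (simp add: \<phi>_def)
    show "(\<Sum>p\<in>I. \<mu> p * x p) \<le> M" if "x \<in> C" for x
      using key[OF inner(1) that] eq[OF inner(1)] by simp
  qed
qed

section \<open>Supports of second derivatives\<close>

lemma mem_local_support: "std i + std j \<in> local_support S \<beta> \<longleftrightarrow> \<beta> + std i + std j \<in> S"
proof
  assume "std i + std j \<in> local_support S \<beta>"
  then obtain k l where "std i + std j = std k + std l" "\<beta> + std k + std l \<in> S"
    unfolding local_support_def by blast
  then show "\<beta> + std i + std j \<in> S" by (metis add.assoc)
qed (auto simp: local_support_def)

lemma local_support_subset: "local_support S \<beta> \<subseteq> {std i + std j | i j. True}"
  unfolding local_support_def by blast

lemma local_support_add: "\<gamma> \<in> local_support S \<beta> \<Longrightarrow> \<beta> + \<gamma> \<in> S"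
  unfolding local_support_def by (auto simp: add.assoc)

lemma local_support_exchange:
  assumes \<gamma>: "\<gamma> \<in> local_support S \<beta>" and pos: "0 < \<gamma> $ i"
    and S: "\<beta> + \<gamma> - std i + std m \<in> S"
  shows "\<gamma> - std i + std m \<in> local_support S \<beta>"
proof -
  obtain p q where pq: "\<gamma> = std p + std q" using \<gamma> local_support_subset by blast
  then have "i = p \<or> i = q" using pos by (auto simp: axis_def split: if_splits)
  then obtain r where r: "\<gamma> = std r + std i" using pq by (metis add.commute)
  then have "\<beta> + \<gamma> - std i = \<beta> + std r" "\<gamma> - std i = std r"
    by (simp_all flip: add.assoc)
  then show ?thesis using S by (simp add: mem_local_support del: One_nat_def)
qed

text \<open>Exchange in \<open>S\<close> between \<open>\<beta> + \<gamma>\<close> and \<open>\<beta> + \<delta>\<close> descends, because cancelling a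
  positive coordinate of \<open>\<gamma>\<close> leaves a unit vector.\<close>

lemma local_support_M_convex:
  assumes M: "M_convex d S"
  shows "local_support S \<beta> = {} \<or> M_convex 2 (local_support S \<beta>)"
proof -
  have "local_support S \<beta> \<subseteq> simplex_pts 2"
  proof
    fix \<gamma> assume "\<gamma> \<in> local_support S \<beta>"
    then obtain p q where "\<gamma> = std p + std q" using local_support_subset by blast
    then show "\<gamma> \<in> simplex_pts 2" by (simp add: simplex_pts_def axis_def sum.distrib)
  qed
  moreover have "\<exists>m. \<gamma> $ m < \<delta> $ m \<and> \<gamma> - std i + std m \<in> local_support S \<beta>
      \<and> \<delta> - std m + std i \<in> local_support S \<beta>"
    if \<gamma>: "\<gamma> \<in> local_support S \<beta>" and \<delta>: "\<delta> \<in> local_support S \<beta>" and lt: "\<delta> $ i < \<gamma> $ i" for \<gamma> \<delta> i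
  proof -
    have "(\<beta> + \<delta>) $ i < (\<beta> + \<gamma>) $ i" using lt by simp
    then obtain m where m: "(\<beta> + \<gamma>) $ m < (\<beta> + \<delta>) $ m"
      "\<beta> + \<gamma> - std i + std m \<in> S" "\<beta> + \<delta> - std m + std i \<in> S"
      using M local_support_add[OF \<gamma>] local_support_add[OF \<delta>] unfolding M_convex_def by blast
    have "\<gamma> $ m < \<delta> $ m" using m(1) by simp
    then show ?thesis
      using local_support_exchange[OF \<gamma> _ m(2)] local_support_exchange[OF \<delta> _ m(3)] lt by auto
  qed
  ultimately show ?thesis unfolding M_convex_def by blast
qed

section \<open>Logarithmic coordinates\<close>

lemma sym_entry_exp_matrix:
  assumes "\<gamma> \<in> T" "T \<subseteq> {std i + std j | i j. True}"
  shows "sym_entry (exp_matrix T a) \<gamma> = exp (a \<gamma>)"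
proof -
  obtain i j where ij: "\<gamma> = std i + std j" using assms by blast
  show ?thesis
    using assms(1) unfolding ij sym_entry_std[OF transpose_exp_matrix] exp_matrix_nth by simp
qed

lemma ratio_exp_matrix:
  assumes "finite T" "T \<subseteq> {std i + std j | i j. True}"
  shows "ratio T w (exp_matrix T a) = exp (pairing T w a)"
  unfolding ratio_def pairing_def exp_sum[OF assms(1)]
  using assms(2) by (intro prod.cong refl) (simp add: sym_entry_exp_matrix exp_powr_real mult.commute)

lemma lorentzian_matrix_iff_exp_matrix:
  "lorentzian_matrix T P \<longleftrightarrow> (\<exists>a\<in>lorentz_logs T. P = exp_matrix T a)"
proof
  assume P: "lorentzian_matrix T P"
  define a where "a \<gamma> = ln (sym_entry P \<gamma>)" for \<gamma>
  have "P $ i $ j = exp_matrix T a $ i $ j" for i j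
    using P unfolding lorentzian_matrix_def
    by (simp add: exp_matrix_nth a_def sym_entry_std del: One_nat_def)
  then have "P = exp_matrix T a" by (simp add: vec_eq_iff)
  then show "\<exists>a\<in>lorentz_logs T. P = exp_matrix T a"
    using P unfolding lorentz_logs_def lorentzian_matrix_def by blast
next
  assume "\<exists>a\<in>lorentz_logs T. P = exp_matrix T a"
  then show "lorentzian_matrix T P"
    unfolding lorentz_logs_def lorentzian_matrix_def
    by (auto simp: transpose_exp_matrix exp_matrix_nth)
qed

definition generator_values :: "generators \<Rightarrow> mindex set \<Rightarrow> (mindex \<Rightarrow> real) \<Rightarrow> nat \<Rightarrow> real" where
  "generator_values g T a = (\<lambda>l. if l < length (g T) then pairing T (g T ! l) a else 0)"

text \<open>The right-hand side is the image of a convex set under a linear map; the convexity of \<open>local_set\<close> comes from here.\<close>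

lemma local_set_eq:
  assumes T: "T = {} \<or> M_convex 2 T" and T2: "T \<subseteq> {std i + std j | i j. True}"
  shows "local_set g T = generator_values g T ` lorentz_logs T"
proof -
  have fin: "finite T" using T finite_M_convex by auto
  have ne: "lorentz_logs T \<noteq> {}" using zero_in_lorentz_logs[OF T] by blast
  show ?thesis
  proof (cases "g T = []")
    case True
    then show ?thesis using ne by (auto simp: local_set_def generator_values_def)
  next
    case False
    have "local_set g T = (\<lambda>a l. if l < length (g T) then ln (ratio T (g T ! l) (exp_matrix T a)) else 0)
        ` lorentz_logs T"
      using False unfolding local_set_def lorentzian_matrix_iff_exp_matrix by auto
    then show ?thesis unfolding ratio_exp_matrix[OF fin T2] ln_exp generator_values_def[abs_def] .
  qed
qed

lemma hess_eq_exp_matrix: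
  assumes "\<And>\<alpha>. norm_coeff f \<alpha> = (if \<alpha> \<in> S then exp (a \<alpha>) else 0)"
  shows "hess f \<beta> = exp_matrix (local_support S \<beta>) (\<lambda>\<gamma>. a (\<beta> + \<gamma>))"
  unfolding hess_def exp_matrix_def assms mem_local_support by (simp only: add.assoc)

text \<open>The logarithms of the normalised coefficients of the Lorentzian polynomials with support \<open>S\<close>.\<close>

definition log_coeffs :: "nat \<Rightarrow> mindex set \<Rightarrow> (mindex \<Rightarrow> real) set" where
  "log_coeffs d S = {a \<in> coord_space S. \<forall>\<beta>\<in>simplex_pts (d - 2).
     (\<lambda>\<gamma>. a (\<beta> + \<gamma>)) \<in> lorentz_logs (local_support S \<beta>)}"

lemma lorentzian_imp_log_coeffs:
  assumes f: "f \<in> lorentzian_with_support d S"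
  shows "\<exists>a\<in>log_coeffs d S. \<forall>\<beta>. hess f \<beta> = exp_matrix (local_support S \<beta>) (\<lambda>\<gamma>. a (\<beta> + \<gamma>))"
proof -
  define a where "a \<alpha> = (if \<alpha> \<in> S then ln (norm_coeff f \<alpha>) else 0)" for \<alpha>
  have keys: "Poly_Mapping.keys f = S" and nn: "0 \<le> Poly_Mapping.lookup f \<alpha>" for \<alpha>
    using f unfolding lorentzian_with_support_def lorentzian_def by auto
  have "norm_coeff f \<alpha> = (if \<alpha> \<in> S then exp (a \<alpha>) else 0)" for \<alpha>
  proof (cases "\<alpha> \<in> S")
    case True
    then have "Poly_Mapping.lookup f \<alpha> \<noteq> 0" using keys by (simp flip: in_keys_iff)
    then have "0 < norm_coeff f \<alpha>" using nn[of \<alpha>] by (simp add: norm_coeff_def prod_pos)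
    then show ?thesis using True by (simp add: a_def)
  next
    case False
    then have "Poly_Mapping.lookup f \<alpha> = 0" unfolding keys[symmetric] in_keys_iff by simp
    then show ?thesis using False by (simp add: norm_coeff_def)
  qed
  from hess_eq_exp_matrix[OF this]
  have h: "hess f \<beta> = exp_matrix (local_support S \<beta>) (\<lambda>\<gamma>. a (\<beta> + \<gamma>))" for \<beta> .
  have "a \<in> coord_space S" by (simp add: coord_space_def a_def)
  moreover have "\<forall>\<beta>\<in>simplex_pts (d - 2). at_most_one_pos_eigenvalue (hess f \<beta>)"
    using f unfolding lorentzian_with_support_def lorentzian_def by blast
  ultimately have "a \<in> log_coeffs d S"
    by (simp add: log_coeffs_def lorentz_logs_def h)
  then show ?thesis using h by blast
qed

lemma log_coeffs_imp_lorentzian: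
  assumes S: "M_convex d S" and a: "a \<in> log_coeffs d S"
  shows "\<exists>f\<in>lorentzian_with_support d S.
    \<forall>\<beta>. hess f \<beta> = exp_matrix (local_support S \<beta>) (\<lambda>\<gamma>. a (\<beta> + \<gamma>))"
proof -
  define c where "c \<alpha> = (if \<alpha> \<in> S then exp (a \<alpha>) / (\<Prod>i\<in>UNIV. fact (\<alpha> $ i)) else 0)" for \<alpha>
  define f where "f = Poly_Mapping.Abs_poly_mapping c"
  have fp: "0 < (\<Prod>i\<in>UNIV. fact (\<alpha> $ i) :: real)" for \<alpha> :: mindex
    by (intro prod_pos) auto
  have "finite {\<alpha>. c \<alpha> \<noteq> 0}"
    by (rule finite_subset[OF _ finite_M_convex[OF S]]) (auto simp: c_def)
  then have lookup: "Poly_Mapping.lookup f = c"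
    unfolding f_def by (rule lookup_Abs_poly_mapping)
  have keys: "Poly_Mapping.keys f = S"
    using fp by (auto simp: in_keys_iff lookup c_def less_imp_neq[symmetric] split: if_splits)
  have "norm_coeff f \<alpha> = (if \<alpha> \<in> S then exp (a \<alpha>) else 0)" for \<alpha>
    using fp[of \<alpha>] by (simp add: norm_coeff_def lookup c_def)
  from hess_eq_exp_matrix[OF this]
  have h: "hess f \<beta> = exp_matrix (local_support S \<beta>) (\<lambda>\<gamma>. a (\<beta> + \<gamma>))" for \<beta> .
  have "0 \<le> c \<alpha>" for \<alpha> using fp[of \<alpha>] by (simp add: c_def)
  moreover have "S \<subseteq> simplex_pts d" using S unfolding M_convex_def by blast
  ultimately have "f \<in> lorentzian_with_support d S"
    using a S unfolding lorentzian_with_support_def lorentzian_def log_coeffs_def lorentz_logs_def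
    by (simp add: keys lookup h)
  then show ?thesis using h by blast
qed

section \<open>The global log-ratio set\<close>

text \<open>The product \<open>C\<close> of the local sets: the blocks for different \<open>\<beta>\<close> vary independently.\<close>

definition ratio_set :: "generators \<Rightarrow> nat \<Rightarrow> mindex set \<Rightarrow> (mindex \<times> nat \<Rightarrow> real) set" where
  "ratio_set g d S = {x \<in> coord_space (gen_index g d S).
     \<forall>\<beta>\<in>simplex_pts (d - 2). (\<lambda>l. x (\<beta>, l)) \<in> local_set g (local_support S \<beta>)}"

lemma rho_block:
  assumes "\<beta> \<in> simplex_pts (d - 2)"
  shows "(\<lambda>l. rho g d S a (\<beta>, l)) = generator_values g (local_support S \<beta>) (\<lambda>\<gamma>. a (\<beta> + \<gamma>))"
  using assms by (auto simp: rho_def generator_values_def pairing_def gen_index_def)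

lemma rho_in_coord_space: "rho g d S a \<in> coord_space (gen_index g d S)"
  unfolding coord_space_def rho_def by auto

lemma finite_gen_index: "finite (gen_index g d S)"
  unfolding gen_index_def using finite_simplex_pts by blast

lemma L_space_linear:
  assumes "x \<in> L_space g d S" "y \<in> L_space g d S"
  shows "(\<lambda>p. u * x p + v * y p) \<in> L_space g d S"
proof -
  obtain a b where a: "a \<in> coord_space S" "x = rho g d S a" and b: "b \<in> coord_space S" "y = rho g d S b"
    using assms unfolding L_space_def by blast
  have "(\<lambda>p. u * x p + v * y p) = rho g d S (\<lambda>\<alpha>. u * a \<alpha> + v * b \<alpha>)"
    by (auto simp: a b rho_def fun_eq_iff sum.distrib sum_distrib_left algebra_simps)
  moreover have "(\<lambda>\<alpha>. u * a \<alpha> + v * b \<alpha>) \<in> coord_space S"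
    using a b unfolding coord_space_def by simp
  ultimately show ?thesis unfolding L_space_def by blast
qed

lemma generator_values_combination:
  "generator_values g T (\<lambda>\<gamma>. u * a \<gamma> + v * b \<gamma>)
    = (\<lambda>l. u * generator_values g T a l + v * generator_values g T b l)"
  by (auto simp: generator_values_def pairing_def fun_eq_iff sum.distrib sum_distrib_left algebra_simps)

lemma ratio_set_convex:
  assumes S: "M_convex d S" and x: "x \<in> ratio_set g d S" and y: "y \<in> ratio_set g d S"
    and uv: "0 \<le> u" "0 \<le> v" "u + v = 1"
  shows "(\<lambda>p. u * x p + v * y p) \<in> ratio_set g d S"
proof -
  have "(\<lambda>l. u * x (\<beta>, l) + v * y (\<beta>, l)) \<in> local_set g (local_support S \<beta>)"
    if \<beta>: "\<beta> \<in> simplex_pts (d - 2)" for \<beta>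
  proof -
    define T where "T = local_support S \<beta>"
    note T = local_support_M_convex[OF S, of \<beta>, folded T_def]
    note T2 = local_support_subset[of S \<beta>, folded T_def]
    obtain a b where a: "a \<in> lorentz_logs T" "(\<lambda>l. x (\<beta>, l)) = generator_values g T a"
      and b: "b \<in> lorentz_logs T" "(\<lambda>l. y (\<beta>, l)) = generator_values g T b"
    proof -
      have "(\<lambda>l. x (\<beta>, l)) \<in> local_set g T" "(\<lambda>l. y (\<beta>, l)) \<in> local_set g T"
        using x y \<beta> unfolding ratio_set_def T_def by blast+
      then show thesis unfolding local_set_eq[OF T T2] using that by blast
    qed
    have "generator_values g T (\<lambda>\<gamma>. u * a \<gamma> + v * b \<gamma>) \<in> local_set g T"
      unfolding local_set_eq[OF T T2] using lorentz_logs_convex[OF T a(1) b(1) uv] by blast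
    then show ?thesis
      unfolding generator_values_combination T_def[symmetric] a(2)[symmetric] b(2)[symmetric] by simp
  qed
  then show ?thesis using x y unfolding ratio_set_def coord_space_def by auto
qed

text \<open>If \<open>\<rho>(a)\<close> lies in the product of the local sets, then every Hessian of the polynomial with
  log-coefficients \<open>a\<close> has the generator ratios of some Lorentzian matrix, and is therefore
  Lorentzian itself. So the local conditions may be imposed separately, and their only
  interaction is through the subspace \<open>L\<close>.\<close>

lemma rho_log_coeffs:
  assumes S: "M_convex d S" and g: "generator_ordering g"
  shows "rho g d S ` log_coeffs d S = L_space g d S \<inter> ratio_set g d S"
proof (intro equalityI subsetI)
  fix x assume "x \<in> rho g d S ` log_coeffs d S"
  then obtain a where a: "a \<in> log_coeffs d S" "x = rho g d S a" by blast
  have "(\<lambda>l. x (\<beta>, l)) \<in> local_set g (local_support S \<beta>)" if "\<beta> \<in> simplex_pts (d - 2)" for \<beta>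
    using a that unfolding a(2) rho_block[OF that]
      local_set_eq[OF local_support_M_convex[OF S] local_support_subset] log_coeffs_def by blast
  then show "x \<in> L_space g d S \<inter> ratio_set g d S"
    using a rho_in_coord_space unfolding L_space_def ratio_set_def log_coeffs_def by auto
next
  fix x assume "x \<in> L_space g d S \<inter> ratio_set g d S"
  then obtain a where a: "a \<in> coord_space S" "x = rho g d S a" and x: "x \<in> ratio_set g d S"
    unfolding L_space_def by blast
  have "(\<lambda>\<gamma>. a (\<beta> + \<gamma>)) \<in> lorentz_logs (local_support S \<beta>)" if \<beta>: "\<beta> \<in> simplex_pts (d - 2)" for \<beta>
  proof -
    define T where "T = local_support S \<beta>"
    note T = local_support_M_convex[OF S, of \<beta>, folded T_def]
    note T2 = local_support_subset[of S \<beta>, folded T_def]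
    have "(\<lambda>l. x (\<beta>, l)) \<in> local_set g T" using x \<beta> unfolding ratio_set_def T_def by blast
    then obtain b where b: "b \<in> lorentz_logs T"
      "generator_values g T (\<lambda>\<gamma>. a (\<beta> + \<gamma>)) = generator_values g T b"
      unfolding a(2) rho_block[OF \<beta>] local_set_eq[OF T T2] T_def[symmetric] by auto
    show ?thesis unfolding T_def[symmetric]
    proof (rule lorentz_logs_downward_closed[OF T T2 b(1)])
      fix u assume "u \<in> local_generators T"
      then have "u \<in> set (g T)" using g T unfolding generator_ordering_def by blast
      then obtain l where l: "l < length (g T)" "u = g T ! l" by (auto simp: in_set_conv_nth)
      then show "pairing T u (\<lambda>\<gamma>. a (\<beta> + \<gamma>)) \<le> pairing T u b"
        using fun_cong[OF b(2), of l] by (simp add: generator_values_def)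
    qed
  qed
  then show "x \<in> rho g d S ` log_coeffs d S" using a unfolding log_coeffs_def by blast
qed

section \<open>An interior point\<close>

text \<open>The log-coefficients \<open>-\<bar>\<alpha>\<bar>\<^sup>2\<close>. As they are quadratic, their generator values do not depend on \<open>\<beta>\<close>.\<close>

definition strictly_concave_point :: "mindex set \<Rightarrow> mindex \<Rightarrow> real" where
  "strictly_concave_point S \<alpha> = (if \<alpha> \<in> S then - (\<Sum>i\<in>UNIV. (real (\<alpha> $ i))\<^sup>2) else 0)"

lemma sum_UNIV_3:
  fixes F :: "3 \<Rightarrow> real"
  assumes "{i, j, k} = UNIV"
  shows "(\<Sum>m\<in>UNIV. F m) = F i + F j + F k"
  using assms[unfolded triple_3] by (subst assms[symmetric]) (simp add: add.assoc)

text \<open>The linear and constant terms in \<open>\<beta>\<close> cancel in a generator. What remains is \<open>-2\<close> for a generator on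
  four points and \<open>-4\<close> for one on three points.\<close>

lemma pairing_strictly_concave_point:
  assumes S: "M_convex d S" and u: "u \<in> local_generators (local_support S \<beta>)"
  shows "pairing (local_support S \<beta>) u (\<lambda>\<gamma>. strictly_concave_point S (\<beta> + \<gamma>)) \<le> - 2"
proof -
  define T where "T = local_support S \<beta>"
  have fin: "finite T" using local_support_M_convex[OF S, of \<beta>] finite_M_convex by (auto simp: T_def)
  have val: "strictly_concave_point S (\<beta> + (std p + std q))
      = - (\<Sum>m\<in>UNIV. (real (\<beta> $ m) + (if m = p then 1 else 0) + (if m = q then 1 else 0))\<^sup>2)"
    if "std p + std q \<in> T" for p q
    using local_support_add[of "std p + std q" S \<beta>] that
    by (auto simp: strictly_concave_point_def T_def axis_nth_std intro!: sum.cong simp del: One_nat_def)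
  from u consider
    (product) i j k where "{i, j, k} = UNIV" "std i + std i \<in> T" "std j + std k \<in> T"
      "std i + std j \<in> T" "std i + std k \<in> T" "u = square_product_generator i j k"
  | (squares) i j where "i \<noteq> j" "T = {std i + std i, std i + std j, std j + std j}"
      "u = two_squares_generator i j"
    unfolding mem_local_generators T_def[symmetric] by blast
  then have "pairing T u (\<lambda>\<gamma>. strictly_concave_point S (\<beta> + \<gamma>)) \<le> - 2"
  proof cases
    case product
    have "i \<noteq> j" "i \<noteq> k" "j \<noteq> k" using product(1) by (auto simp: triple_3)
    then show ?thesis
      unfolding product(6) pairing_square_product[OF fin product(2-5)]
        val[OF product(2)] val[OF product(3)] val[OF product(4)] val[OF product(5)]
        sum_UNIV_3[OF product(1)]
      by (simp add: power2_eq_square algebra_simps)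
  next
    case squares
    then have mem: "std i + std i \<in> T" "std i + std j \<in> T" "std j + std j \<in> T" by auto
    obtain k where ijk: "{i, j, k} = UNIV" using \<open>i \<noteq> j\<close> by (rule ex_third_index)
    then have "i \<noteq> j" "i \<noteq> k" "j \<noteq> k" by (auto simp: triple_3)
    then show ?thesis
      unfolding squares(3) pairing_two_squares[OF fin mem]
        val[OF mem(1)] val[OF mem(2)] val[OF mem(3)] sum_UNIV_3[OF ijk]
      by (simp add: power2_eq_square algebra_simps)
  qed
  then show ?thesis by (simp add: T_def)
qed

lemma generator_values_pivot:
  assumes T: "T = {} \<or> M_convex 2 T" and g: "generator_ordering g" and l: "l < length (g T)"
  obtains \<gamma> where "\<And>a r. generator_values g T (a(\<gamma> := a \<gamma> + r))
    = (generator_values g T a)(l := generator_values g T a l + r)"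
proof -
  have gT: "distinct (g T)" "set (g T) = local_generators T"
    using g T unfolding generator_ordering_def by blast+
  have fin: "finite T" using T finite_M_convex by auto
  have gl: "g T ! l \<in> local_generators T" using l gT(2) nth_mem by blast
  obtain \<gamma> where \<gamma>: "\<gamma> \<in> T" "(g T ! l) \<gamma> = 1"
    "\<And>v. v \<in> local_generators T \<Longrightarrow> v \<noteq> g T ! l \<Longrightarrow> v \<gamma> = 0"
    using local_generator_pivot[OF gl] by blast
  have upd: "pairing T u (a(\<gamma> := a \<gamma> + r)) = pairing T u a + u \<gamma> * r" for u a r
  proof -
    have "pairing T u (a(\<gamma> := a \<gamma> + r)) = (\<Sum>\<delta>\<in>T. u \<delta> * a \<delta> + (if \<delta> = \<gamma> then u \<gamma> * r else 0))"
      unfolding pairing_def by (intro sum.cong) (auto simp: algebra_simps)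
    then show ?thesis using fin \<gamma>(1) by (simp add: sum.distrib pairing_def)
  qed
  have coeff: "(g T ! l') \<gamma> = (if l' = l then 1 else 0)" if "l' < length (g T)" for l'
  proof (cases "l' = l")
    case False
    then have "g T ! l' \<noteq> g T ! l" using nth_eq_iff_index_eq[OF gT(1) that l] by simp
    moreover have "g T ! l' \<in> local_generators T" using that gT(2) nth_mem by blast
    ultimately show ?thesis using \<gamma>(3) False by simp
  qed (use \<gamma>(2) in simp)
  show thesis
  proof (rule that[of \<gamma>], rule ext)
    fix a r l'
    show "generator_values g T (a(\<gamma> := a \<gamma> + r)) l'
      = ((generator_values g T a)(l := generator_values g T a l + r)) l'"
      unfolding generator_values_def upd using coeff[of l'] l by (cases "l' = l") auto
  qed
qed

lemma nonpositive_in_lorentz_logs: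
  assumes T: "T = {} \<or> M_convex 2 T" and T2: "T \<subseteq> {std i + std j | i j. True}"
    and g: "generator_ordering g" and le: "\<And>l. generator_values g T a l \<le> 0"
  shows "a \<in> lorentz_logs T"
proof (rule lorentz_logs_downward_closed[OF T T2 zero_in_lorentz_logs[OF T]])
  fix u assume "u \<in> local_generators T"
  then have "u \<in> set (g T)" using g T unfolding generator_ordering_def by blast
  then obtain l where "l < length (g T)" "u = g T ! l" by (auto simp: in_set_conv_nth)
  then show "pairing T u a \<le> pairing T u (\<lambda>_. 0)"
    using le[of l] by (simp add: generator_values_def pairing_def)
qed

text \<open>Vectors with nonpositive generator values are Lorentzian, so the log-ratio vector of the strictly
  concave point, whose entries are at most \<open>-2\<close>, is interior to the product of the local
  sets; by the pivots every unit step from it stays inside. This is the constraint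
  qualification for the duality theorem.\<close>

lemma interior_point:
  assumes S: "M_convex d S" and g: "generator_ordering g"
  shows "\<exists>x\<in>L_space g d S \<inter> ratio_set g d S.
    \<forall>q\<in>gen_index g d S. \<forall>r\<le>1. x(q := x q + r) \<in> ratio_set g d S"
proof -
  define a where "a = strictly_concave_point S"
  define x where "x = rho g d S a"
  have L: "x \<in> L_space g d S"
    unfolding x_def L_space_def a_def by (auto simp: coord_space_def strictly_concave_point_def)
  have block: "(\<lambda>l. x (\<beta>, l)) = generator_values g (local_support S \<beta>) (\<lambda>\<gamma>. a (\<beta> + \<gamma>))"
    if "\<beta> \<in> simplex_pts (d - 2)" for \<beta>
    unfolding x_def using that by (rule rho_block)
  have neg: "generator_values g (local_support S \<beta>) (\<lambda>\<gamma>. a (\<beta> + \<gamma>)) l \<le> - 2"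
    if "l < length (g (local_support S \<beta>))" for \<beta> l
  proof -
    have "g (local_support S \<beta>) ! l \<in> set (g (local_support S \<beta>))"
      using that by (rule nth_mem)
    also have "set (g (local_support S \<beta>)) = local_generators (local_support S \<beta>)"
      using g local_support_M_convex[OF S, of \<beta>] unfolding generator_ordering_def by blast
    finally show ?thesis
      using pairing_strictly_concave_point[OF S] that unfolding generator_values_def a_def by simp
  qed
  have shifted: "x(q := x q + r) \<in> ratio_set g d S"
    if q: "q \<in> gen_index g d S \<or> r = 0" and r: "r \<le> 1" for q r
  proof -
    have "(\<lambda>l. (x(q := x q + r)) (\<beta>, l)) \<in> local_set g (local_support S \<beta>)"
      if \<beta>: "\<beta> \<in> simplex_pts (d - 2)" for \<beta>
    proof -
      define T where "T = local_support S \<beta>"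
      note T = local_support_M_convex[OF S, of \<beta>, folded T_def]
      note T2 = local_support_subset[of S \<beta>, folded T_def]
      define b where "b = (\<lambda>\<gamma>. a (\<beta> + \<gamma>))"
      have b: "generator_values g T b l \<le> - 2" if "l < length (g T)" for l
        using neg that unfolding T_def b_def .
      have b0: "generator_values g T b l = 0" if "\<not> l < length (g T)" for l
        using that by (simp add: generator_values_def)
      have "\<exists>c. (\<lambda>l. (x(q := x q + r)) (\<beta>, l)) = generator_values g T c \<and>
          (\<forall>l. generator_values g T c l \<le> 0)"
      proof (cases "fst q = \<beta> \<and> r \<noteq> 0")
        case True
        then obtain l where ql: "q = (\<beta>, l)" "l < length (g T)"
          using q by (cases q) (auto simp: gen_index_def T_def)
        obtain \<gamma> where \<gamma>: "\<And>a r. generator_values g T (a(\<gamma> := a \<gamma> + r))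
            = (generator_values g T a)(l := generator_values g T a l + r)"
          using generator_values_pivot[OF T g ql(2)] by blast
        have "(\<lambda>l. (x(q := x q + r)) (\<beta>, l)) = (\<lambda>l. x (\<beta>, l))(l := x (\<beta>, l) + r)"
          by (auto simp: ql)
        also have "\<dots> = generator_values g T (b(\<gamma> := b \<gamma> + r))"
          unfolding \<gamma> using block[OF \<beta>] by (simp add: T_def b_def fun_eq_iff)
        finally have "(\<lambda>l. (x(q := x q + r)) (\<beta>, l)) = generator_values g T (b(\<gamma> := b \<gamma> + r))" .
        moreover have "generator_values g T (b(\<gamma> := b \<gamma> + r)) l' \<le> 0" for l'
        proof (cases "l' = l")
          case True
          then show ?thesis using b[OF ql(2)] r unfolding \<gamma> by simp
        next
          case False
          then show ?thesis using b[of l'] b0[of l'] unfolding \<gamma> by fastforce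
        qed
        ultimately show ?thesis by blast
      next
        case False
        then have "(\<lambda>l. (x(q := x q + r)) (\<beta>, l)) = generator_values g T b"
          using block[OF \<beta>] by (auto simp: T_def b_def fun_eq_iff)
        moreover have "generator_values g T b l \<le> 0" for l
          using b[of l] b0[of l] by linarith
        ultimately show ?thesis by blast
      qed
      then obtain c where c: "(\<lambda>l. (x(q := x q + r)) (\<beta>, l)) = generator_values g T c"
        "\<And>l. generator_values g T c l \<le> 0" by blast
      have "c \<in> lorentz_logs T" by (rule nonpositive_in_lorentz_logs[OF T T2 g c(2)])
      then show ?thesis
        unfolding T_def[symmetric] local_set_eq[OF T T2] c(1) by (rule imageI)
    qed
    moreover have "x(q := x q + r) \<in> coord_space (gen_index g d S)"
      using q rho_in_coord_space[of g d S a] by (auto simp: x_def coord_space_def)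
    ultimately show ?thesis unfolding ratio_set_def by blast
  qed
  show ?thesis
  proof (intro bexI[of _ x] ballI allI impI IntI)
    show "x \<in> ratio_set g d S" using shifted[of _ 0] by simp
    show "x(q := x q + r) \<in> ratio_set g d S" if "q \<in> gen_index g d S" "r \<le> 1" for q r
      using that by (intro shifted) auto
  qed (rule L)
qed

section \<open>Suprema in the extended reals\<close>

lemma ereal_ln_SUP_exp:
  assumes "A \<noteq> {}"
  shows "ereal_ln (SUP a\<in>A. ereal (exp (h a))) = (SUP a\<in>A. ereal (h a))"
proof -
  define X where "X = (SUP a\<in>A. ereal (exp (h a)))"
  have up: "ereal (exp (h a)) \<le> X" if "a \<in> A" for a
    unfolding X_def using that by (rule SUP_upper)
  obtain a0 where a0: "a0 \<in> A" using assms by blast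
  have "0 < ereal (exp (h a0))" by simp
  then have "0 < X" using up[OF a0] by (rule less_le_trans)
  show ?thesis
  proof (cases X)
    case (real x)
    have x: "0 < x" using \<open>0 < X\<close> real by simp
    have "(SUP a\<in>A. ereal (h a)) = ereal (ln x)"
    proof (rule SUP_eqI)
      show "ereal (h a) \<le> ereal (ln x)" if "a \<in> A" for a
        using up[OF that] x by (simp add: real ln_ge_iff)
    next
      fix y assume y: "\<And>a. a \<in> A \<Longrightarrow> ereal (h a) \<le> y"
      show "ereal (ln x) \<le> y"
      proof (cases y)
        case (real r)
        have "X \<le> ereal (exp r)" unfolding X_def using y real by (intro SUP_least) simp
        then have "x \<le> exp r" using \<open>X = ereal x\<close> by simp
        then have "ln x \<le> r" using x by (metis ln_exp ln_le_cancel_iff exp_gt_zero)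
        then show ?thesis using real by simp
      qed (use y[OF a0] in auto)
    qed
    then show ?thesis using \<open>0 < X\<close> by (simp add: ereal_ln_def real flip: X_def)
  next
    case PInf
    have "(SUP a\<in>A. ereal (h a)) = \<infinity>"
    proof (rule SUP_PInfty)
      fix n :: nat
      have "ereal (exp (real n)) < X" using PInf by simp
      then obtain a where "a \<in> A" "ereal (exp (real n)) < ereal (exp (h a))"
        unfolding X_def less_SUP_iff by blast
      then show "\<exists>a\<in>A. ereal (real n) \<le> ereal (h a)" by (auto intro: less_imp_le)
    qed
    then show ?thesis using PInf by (simp add: ereal_ln_def flip: X_def)
  qed (use \<open>0 < X\<close> in auto)
qed

text \<open>The index sets are independent, so the summands can approach their suprema simultaneously; one
  summand is released at a time. Nonemptiness keeps the value \<open>-\<infinity>\<close> out of the sum.\<close>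

lemma sum_SUP_le:
  assumes "finite B" and "\<And>b. b \<in> B \<Longrightarrow> X b \<noteq> {}"
    and "\<And>x. (\<And>b. b \<in> B \<Longrightarrow> x b \<in> X b) \<Longrightarrow> (\<Sum>b\<in>B. f b (x b)) \<le> M"
  shows "(\<Sum>b\<in>B. SUP y\<in>X b. ereal (f b y)) \<le> ereal M"
  using assms
proof (induction B arbitrary: M rule: finite_induct)
  case empty
  then show ?case by (simp add: zero_ereal_def)
next
  case (insert b B)
  define R where "R = (\<Sum>b\<in>B. SUP y\<in>X b. ereal (f b y))"
  have step: "ereal (f b y) + R \<le> ereal M" if y: "y \<in> X b" for y
  proof -
    have "R \<le> ereal (M - f b y)"
      unfolding R_def
    proof (rule insert.IH)
      fix x assume x: "\<And>c. c \<in> B \<Longrightarrow> x c \<in> X c"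
      have "(\<Sum>c\<in>insert b B. f c ((x(b := y)) c)) \<le> M"
      proof (rule insert.prems(2))
        show "(x(b := y)) c \<in> X c" if "c \<in> insert b B" for c using that x y by auto
      qed
      moreover have "(\<Sum>c\<in>B. f c ((x(b := y)) c)) = (\<Sum>c\<in>B. f c (x c))"
        using insert.hyps by (intro sum.cong) auto
      ultimately show "(\<Sum>c\<in>B. f c (x c)) \<le> M - f b y"
        using insert.hyps by simp
    qed (use insert.prems in auto)
    then show ?thesis by (cases R) auto
  qed
  have "\<forall>c\<in>B. \<exists>y. y \<in> X c" using insert.prems(1) by blast
  then have "\<exists>y. \<forall>c\<in>B. y c \<in> X c" by (rule bchoice)
  then obtain y where y: "\<forall>c\<in>B. y c \<in> X c" by blast
  have "ereal (\<Sum>c\<in>B. f c (y c)) = (\<Sum>c\<in>B. ereal (f c (y c)))" by simp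
  also have "\<dots> \<le> R"
    unfolding R_def using y by (intro sum_mono SUP_upper) auto
  finally have "R \<noteq> -\<infinity>" by auto
  then have "(SUP y\<in>X b. ereal (f b y)) + R = (SUP y\<in>X b. ereal (f b y) + R)"
    using insert.prems(1)[of b] by (intro SUP_ereal_add_left[symmetric]) auto
  also have "\<dots> \<le> ereal M" using step by (rule SUP_least)
  finally show ?case using insert.hyps by (simp add: R_def)
qed

section \<open>Duality\<close>

text \<open>In logarithmic coordinates the objective becomes linear and the constraint set becomes
  \<open>L \<inter> ratio_set\<close>.\<close>

lemma H_fun_eq_SUP:
  assumes S: "M_convex d S" and g: "generator_ordering g"
  shows "H_fun g d S lam = (SUP x\<in>L_space g d S \<inter> ratio_set g d S.
    ereal (\<Sum>p\<in>gen_index g d S. lam p * x p))"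
proof -
  define G where "G a = (\<Sum>p\<in>gen_index g d S. lam p * rho g d S a p)" for a
  have prod: "(\<Prod>p\<in>gen_index g d S. poly_ratio g S f p powr lam p) = exp (G a)"
    if "\<forall>\<beta>. hess f \<beta> = exp_matrix (local_support S \<beta>) (\<lambda>\<gamma>. a (\<beta> + \<gamma>))" for f a
  proof -
    have h: "hess f \<beta> = exp_matrix (local_support S \<beta>) (\<lambda>\<gamma>. a (\<beta> + \<gamma>))" for \<beta>
      using that by (rule spec)
    have "poly_ratio g S f p powr lam p = exp (lam p * rho g d S a p)"
      if p: "p \<in> gen_index g d S" for p
    proof -
      obtain \<beta> l where \<beta>l: "p = (\<beta>, l)" "\<beta> \<in> simplex_pts (d - 2)" "l < length (g (local_support S \<beta>))"
        using p unfolding gen_index_def by auto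
      have fin: "finite (local_support S \<beta>)"
        using local_support_M_convex[OF S, of \<beta>] finite_M_convex by auto
      have "rho g d S a p = pairing (local_support S \<beta>) (g (local_support S \<beta>) ! l) (\<lambda>\<gamma>. a (\<beta> + \<gamma>))"
        using fun_cong[OF rho_block[OF \<beta>l(2), of g S a], of l] \<beta>l by (simp add: generator_values_def)
      moreover have "poly_ratio g S f p
        = exp (pairing (local_support S \<beta>) (g (local_support S \<beta>) ! l) (\<lambda>\<gamma>. a (\<beta> + \<gamma>)))"
        unfolding poly_ratio_def \<beta>l(1) prod.case h
        by (rule ratio_exp_matrix[OF fin local_support_subset])
      ultimately show ?thesis by (simp add: exp_powr_real mult.commute)
    qed
    then show ?thesis by (simp add: G_def exp_sum finite_gen_index)
  qed
  have "(\<lambda>f. ereal (\<Prod>p\<in>gen_index g d S. poly_ratio g S f p powr lam p)) ` lorentzian_with_support d S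
      = (\<lambda>a. ereal (exp (G a))) ` log_coeffs d S"
  proof (intro equalityI image_subsetI)
    fix f assume "f \<in> lorentzian_with_support d S"
    then obtain a where a: "a \<in> log_coeffs d S"
      "\<forall>\<beta>. hess f \<beta> = exp_matrix (local_support S \<beta>) (\<lambda>\<gamma>. a (\<beta> + \<gamma>))"
      by (rule lorentzian_imp_log_coeffs[THEN bexE])
    show "ereal (\<Prod>p\<in>gen_index g d S. poly_ratio g S f p powr lam p)
        \<in> (\<lambda>a. ereal (exp (G a))) ` log_coeffs d S"
      unfolding prod[OF a(2)] using a(1) by (rule imageI)
  next
    fix a assume "a \<in> log_coeffs d S"
    then obtain f where f: "f \<in> lorentzian_with_support d S"
      "\<forall>\<beta>. hess f \<beta> = exp_matrix (local_support S \<beta>) (\<lambda>\<gamma>. a (\<beta> + \<gamma>))"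
      by (rule log_coeffs_imp_lorentzian[OF S, THEN bexE])
    show "ereal (exp (G a)) \<in> (\<lambda>f. ereal (\<Prod>p\<in>gen_index g d S. poly_ratio g S f p powr lam p))
        ` lorentzian_with_support d S"
      unfolding prod[OF f(2), symmetric] using f(1) by (rule imageI)
  qed
  then have "H_fun g d S lam = ereal_ln (SUP a\<in>log_coeffs d S. ereal (exp (G a)))"
    unfolding H_fun_def by simp
  also have "\<dots> = (SUP a\<in>log_coeffs d S. ereal (G a))"
  proof (rule ereal_ln_SUP_exp)
    obtain x where "x \<in> L_space g d S \<inter> ratio_set g d S"
      by (rule interior_point[OF S g, THEN bexE])
    then show "log_coeffs d S \<noteq> {}" using rho_log_coeffs[OF S g] by blast
  qed
  also have "\<dots> = (SUP x\<in>rho g d S ` log_coeffs d S. ereal (\<Sum>p\<in>gen_index g d S. lam p * x p))"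
    unfolding G_def image_image ..
  finally show ?thesis unfolding rho_log_coeffs[OF S g] .
qed

lemma sum_gen_index:
  "(\<Sum>p\<in>gen_index g d S. F p)
    = (\<Sum>\<beta>\<in>simplex_pts (d - 2). \<Sum>l<length (g (local_support S \<beta>)). F (\<beta>, l))"
  unfolding gen_index_def by (subst sum.Sigma) (auto simp: finite_simplex_pts)

text \<open>Each summand is estimated by the support function of its own block.\<close>

lemma weak_duality:
  fixes F :: "mindex \<times> nat \<Rightarrow> real"
  assumes "x \<in> ratio_set g d S"
  shows "ereal (\<Sum>p\<in>gen_index g d S. F p * x p)
    \<le> (\<Sum>\<beta>\<in>simplex_pts (d - 2). local_support_fun g (local_support S \<beta>) (\<lambda>l. F (\<beta>, l)))"
proof -
  have "ereal (\<Sum>p\<in>gen_index g d S. F p * x p) = (\<Sum>\<beta>\<in>simplex_pts (d - 2).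
      ereal (\<Sum>l<length (g (local_support S \<beta>)). F (\<beta>, l) * x (\<beta>, l)))"
    unfolding sum_gen_index by simp
  also have "\<dots> \<le> (\<Sum>\<beta>\<in>simplex_pts (d - 2). local_support_fun g (local_support S \<beta>) (\<lambda>l. F (\<beta>, l)))"
    unfolding local_support_fun_def
  proof (rule sum_mono)
    fix \<beta> assume "\<beta> \<in> simplex_pts (d - 2)"
    then have "(\<lambda>l. x (\<beta>, l)) \<in> local_set g (local_support S \<beta>)"
      using assms unfolding ratio_set_def by blast
    from SUP_upper[OF this, of "\<lambda>y. ereal (\<Sum>l<length (g (local_support S \<beta>)). F (\<beta>, l) * y l)"]
    show "ereal (\<Sum>l<length (g (local_support S \<beta>)). F (\<beta>, l) * x (\<beta>, l))
        \<le> (SUP y\<in>local_set g (local_support S \<beta>).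
            ereal (\<Sum>l<length (g (local_support S \<beta>)). F (\<beta>, l) * y l))" .
  qed
  finally show ?thesis .
qed

text \<open>A point of the product of the local sets can be chosen block by block.\<close>

lemma sum_local_support_fun_le:
  assumes S: "M_convex d S"
    and bound: "\<And>x. x \<in> ratio_set g d S \<Longrightarrow> (\<Sum>p\<in>gen_index g d S. F p * x p) \<le> M"
  shows "(\<Sum>\<beta>\<in>simplex_pts (d - 2). local_support_fun g (local_support S \<beta>) (\<lambda>l. F (\<beta>, l)))
    \<le> ereal M"
  unfolding local_support_fun_def
proof (rule sum_SUP_le[OF finite_simplex_pts])
  fix \<beta>
  note T = local_support_M_convex[OF S, of \<beta>]
  show "local_set g (local_support S \<beta>) \<noteq> {}"
    using zero_in_lorentz_logs[OF T] unfolding local_set_eq[OF T local_support_subset] by blast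
next
  fix y assume y: "\<And>\<beta>. \<beta> \<in> simplex_pts (d - 2) \<Longrightarrow> y \<beta> \<in> local_set g (local_support S \<beta>)"
  define x where "x = (\<lambda>(\<beta>, l). if \<beta> \<in> simplex_pts (d - 2) then y \<beta> l else 0)"
  have block: "(\<lambda>l. x (\<beta>, l)) = y \<beta>" if "\<beta> \<in> simplex_pts (d - 2)" for \<beta>
    using that by (simp add: x_def)
  have zero: "y \<beta> l = 0"
    if "\<beta> \<in> simplex_pts (d - 2)" "\<not> l < length (g (local_support S \<beta>))" for \<beta> l
    using y[OF that(1)] that(2)
    unfolding local_set_eq[OF local_support_M_convex[OF S] local_support_subset]
    by (auto simp: generator_values_def)
  have "x \<in> ratio_set g d S"
    using y block zero by (auto simp: ratio_set_def coord_space_def gen_index_def x_def)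
  from bound[OF this]
  show "(\<Sum>\<beta>\<in>simplex_pts (d - 2). \<Sum>l<length (g (local_support S \<beta>)). F (\<beta>, l) * y \<beta> l) \<le> M"
    unfolding sum_gen_index by (simp add: x_def)
qed

text \<open>The functional \<open>\<lambda>\<close> on \<open>L\<close> extends to one with coefficients \<open>\<mu>\<close> that has the same bound
  on the whole product of local sets; \<open>\<eta> = \<mu> - \<lambda>\<close> is then orthogonal to \<open>L\<close>. In particular a finite
  infimum is attained.\<close>

lemma strong_duality:
  assumes S: "M_convex d S" and g: "generator_ordering g"
    and bound: "\<And>x. x \<in> L_space g d S \<Longrightarrow> x \<in> ratio_set g d S \<Longrightarrow>
      (\<Sum>p\<in>gen_index g d S. lam p * x p) \<le> M"
  obtains \<eta> where "\<eta> \<in> L_perp g d S"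
    "(\<Sum>\<beta>\<in>simplex_pts (d - 2). local_support_fun g (local_support S \<beta>)
        (\<lambda>l. lam (\<beta>, l) + \<eta> (\<beta>, l))) \<le> ereal M"
proof -
  let ?I = "gen_index g d S"
  obtain x0 where "x0 \<in> L_space g d S \<inter> ratio_set g d S"
    and shift: "\<forall>q\<in>?I. \<forall>r\<le>1. x0(q := x0 q + r) \<in> ratio_set g d S"
    by (rule interior_point[OF S g, THEN bexE])
  then have x0: "x0 \<in> L_space g d S" "x0 \<in> ratio_set g d S" by auto
  obtain \<mu> where \<mu>: "\<And>x. x \<in> L_space g d S \<Longrightarrow> (\<Sum>p\<in>?I. \<mu> p * x p) = (\<Sum>p\<in>?I. lam p * x p)"
    "\<And>x. x \<in> ratio_set g d S \<Longrightarrow> (\<Sum>p\<in>?I. \<mu> p * x p) \<le> M"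
  proof (rule bounded_functional_extends[where I = ?I and C = "ratio_set g d S"
        and L = "L_space g d S" and c = x0 and \<delta> = 1 and lam = lam and M = M])
    show "x0(q := x0 q - 1) \<in> ratio_set g d S" if "q \<in> ?I" for q
      using shift[rule_format, OF that, of "-1"] by simp
    show "L_space g d S \<subseteq> coord_space ?I"
      unfolding L_space_def using rho_in_coord_space by blast
    show "ratio_set g d S \<subseteq> coord_space ?I" unfolding ratio_set_def by blast
    show "(\<lambda>p. u * x p + v * y p) \<in> ratio_set g d S"
      if "x \<in> ratio_set g d S" "y \<in> ratio_set g d S" "0 \<le> u" "0 \<le> v" "u + v = 1" for x y u v
      using that by (rule ratio_set_convex[OF S])
    show "(\<lambda>p. u * x p + v * y p) \<in> L_space g d S"
      if "x \<in> L_space g d S" "y \<in> L_space g d S" for x y u v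
      using that by (rule L_space_linear)
    show "x0(q := x0 q + 1) \<in> ratio_set g d S" if "q \<in> ?I" for q
      using shift[rule_format, OF that, of 1] by simp
    show "(\<Sum>p\<in>?I. lam p * x p) \<le> M" if "x \<in> L_space g d S" "x \<in> ratio_set g d S" for x
      using that by (rule bound)
  qed (use finite_gen_index x0(1,2) in auto)
  define \<eta> where "\<eta> p = (if p \<in> ?I then \<mu> p - lam p else 0)" for p
  have sum: "(\<Sum>p\<in>?I. (lam p + \<eta> p) * x p) = (\<Sum>p\<in>?I. \<mu> p * x p)" for x
    by (intro sum.cong) (auto simp: \<eta>_def)
  have "(\<Sum>p\<in>?I. \<eta> p * x p) = 0" if "x \<in> L_space g d S" for x
    using sum[of x] \<mu>(1)[OF that] by (simp add: distrib_right sum.distrib)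
  then have "\<eta> \<in> L_perp g d S"
    by (simp add: L_perp_def coord_space_def \<eta>_def)
  moreover have "(\<Sum>\<beta>\<in>simplex_pts (d - 2). local_support_fun g (local_support S \<beta>)
      (\<lambda>l. lam (\<beta>, l) + \<eta> (\<beta>, l))) \<le> ereal M"
    by (rule sum_local_support_fun_le[OF S, where F = "\<lambda>p. lam p + \<eta> p"]) (simp add: sum \<mu>(2))
  ultimately show thesis by (rule that)
qed

theorem theorem2:
  fixes d :: nat and S :: "mindex set" and g :: generators
    and lam :: "mindex \<times> nat \<Rightarrow> real"
  assumes "d \<ge> 2"
    and "generator_ordering g"
    and "M_convex d S"
    and "lam \<in> coord_space (gen_index g d S)"
    and "\<And>p. p \<in> gen_index g d S \<Longrightarrow> 0 \<le> lam p"
  shows "H_fun g d S lam =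
    (INF \<eta>\<in>L_perp g d S. \<Sum>\<beta>\<in>simplex_pts (d - 2).
       local_support_fun g (local_support S \<beta>) (\<lambda>l. lam (\<beta>, l) + \<eta> (\<beta>, l)))"
proof (rule antisym)
  let ?I = "gen_index g d S"
  let ?V = "L_space g d S \<inter> ratio_set g d S"
  note g = assms(2) and S = assms(3)
  note H = H_fun_eq_SUP[OF S g, of lam]
  show "H_fun g d S lam \<le> (INF \<eta>\<in>L_perp g d S. \<Sum>\<beta>\<in>simplex_pts (d - 2).
       local_support_fun g (local_support S \<beta>) (\<lambda>l. lam (\<beta>, l) + \<eta> (\<beta>, l)))"
    unfolding H
  proof (intro INF_greatest SUP_least)
    fix \<eta> x assume \<eta>: "\<eta> \<in> L_perp g d S" and x: "x \<in> ?V"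
    have "(\<Sum>p\<in>?I. \<eta> p * x p) = 0" using \<eta> x unfolding L_perp_def by blast
    then have "(\<Sum>p\<in>?I. lam p * x p) = (\<Sum>p\<in>?I. (lam p + \<eta> p) * x p)"
      by (simp add: distrib_right sum.distrib)
    then show "ereal (\<Sum>p\<in>?I. lam p * x p) \<le> (\<Sum>\<beta>\<in>simplex_pts (d - 2).
       local_support_fun g (local_support S \<beta>) (\<lambda>l. lam (\<beta>, l) + \<eta> (\<beta>, l)))"
      using weak_duality[of x g d S "\<lambda>p. lam p + \<eta> p"] x by simp
  qed
  show "(INF \<eta>\<in>L_perp g d S. \<Sum>\<beta>\<in>simplex_pts (d - 2).
       local_support_fun g (local_support S \<beta>) (\<lambda>l. lam (\<beta>, l) + \<eta> (\<beta>, l))) \<le> H_fun g d S lam"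
  proof (cases "H_fun g d S lam")
    case (real M)
    have "(\<Sum>p\<in>?I. lam p * x p) \<le> M" if "x \<in> L_space g d S" "x \<in> ratio_set g d S" for x
      using SUP_upper[of x ?V "\<lambda>x. ereal (\<Sum>p\<in>?I. lam p * x p)"] that
      unfolding H[symmetric] real by simp
    then obtain \<eta> where "\<eta> \<in> L_perp g d S"
      "(\<Sum>\<beta>\<in>simplex_pts (d - 2). local_support_fun g (local_support S \<beta>)
        (\<lambda>l. lam (\<beta>, l) + \<eta> (\<beta>, l))) \<le> ereal M"
      by (rule strong_duality[OF S g])
    then show ?thesis unfolding real by (rule INF_lower2[of \<eta>])
  next
    case MInf
    obtain x where "x \<in> ?V" by (rule interior_point[OF S g, THEN bexE])
    then have "ereal (\<Sum>p\<in>?I. lam p * x p) \<le> H_fun g d S lam" unfolding H by (rule SUP_upper)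
    then show ?thesis using MInf by simp
  qed simp
qed

end
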